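(* Let $D=(d_1,\dots,d_n)$ be a non-increasing graphic degree sequence satisfying $$\forall k\in\{1,\dots,n\}:\quad \sum_{i=1}^k d_i\le k(k-1)+d_n(n-k)+1.$$ Then $\mathrm{pp}(D)\le 3n^9$.
   Context: For an integer sequence $D$ of length $n$, $\mathcal G(D)$ is the set of simple graphs on the labelled vertex set $\{v_1,\dots,v_n\}$ with $\deg(v_i)=d_i$ (empty if some entry is negative); $D$ is graphic if $\mathcal G(D)\neq\emptyset$. $1^{-i}_{-j}$ is the vector with $-1$ in coordinates $i,j$ and $0$ elsewhere. $\mathrm{pp}(D)=\sum_{1\le i<j\le n}|\mathcal G(D+1^{-i}_{-j})|/|\mathcal G(D)|$. *)

theory Defs
  imports Complex_Main
begin

text \<open>
  The vertex \<open>v\<^sub>i\<close> is identified with its index \<open>i \<in> {1..n}\<close>, and a simple graph on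
  \<open>{1..n}\<close> with its set of edges, each edge being a two-element set of vertices.
  An integer sequence of length \<open>n\<close> is a function \<open>d :: nat \<Rightarrow> int\<close> of which only the
  values on \<open>{1..n}\<close> are used.
\<close>

definition simple_graphs :: "nat \<Rightarrow> nat set set set" where
  "simple_graphs n = {E. \<forall>e\<in>E. e \<subseteq> {1..n} \<and> card e = 2}"

definition vertex_degree :: "nat set set \<Rightarrow> nat \<Rightarrow> nat" where
  "vertex_degree E v = card {e \<in> E. v \<in> e}"

definition realizations :: "nat \<Rightarrow> (nat \<Rightarrow> int) \<Rightarrow> nat set set set" where
  "realizations n d = {E \<in> simple_graphs n. \<forall>i\<in>{1..n}. int (vertex_degree E i) = d i}"

definition graphic :: "nat \<Rightarrow> (nat \<Rightarrow> int) \<Rightarrow> bool" where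
  "graphic n d \<longleftrightarrow> realizations n d \<noteq> {}"

definition nonincreasing :: "nat \<Rightarrow> (nat \<Rightarrow> int) \<Rightarrow> bool" where
  "nonincreasing n d \<longleftrightarrow> (\<forall>i\<in>{1..n}. \<forall>j\<in>{1..n}. i \<le> j \<longrightarrow> d j \<le> d i)"

text \<open>The vector \<open>1\<close> with upper index \<open>-i\<close> and lower index \<open>-j\<close>; used for \<open>i \<noteq> j\<close> only.\<close>

definition minus_ones :: "nat \<Rightarrow> nat \<Rightarrow> nat \<Rightarrow> int" where
  "minus_ones i j = (\<lambda>v. if v = i \<or> v = j then -1 else 0)"

definition pp :: "nat \<Rightarrow> (nat \<Rightarrow> int) \<Rightarrow> real" where
  "pp n d = (\<Sum>i=1..n. \<Sum>j=i+1..n.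
     real (card (realizations n (\<lambda>v. d v + minus_ones i j v))) / real (card (realizations n d)))"

text \<open>The cardinalities above are genuine, since all sets of graphs involved are finite.\<close>

lemma finite_simple_graphs: "finite (simple_graphs n)"
proof (rule finite_subset)
  show "simple_graphs n \<subseteq> Pow (Pow {1..n})"
    by (auto simp: simple_graphs_def)
qed simp

lemma finite_edges: "E \<in> simple_graphs n \<Longrightarrow> finite E"
  by (rule finite_subset[of _ "Pow {1..n}"]) (auto simp: simple_graphs_def)

lemma finite_realizations: "finite (realizations n d)"
  by (rule finite_subset[OF _ finite_simple_graphs[of n]]) (auto simp: realizations_def)

end

(*
  Let s, t be the two vertices of a graph E whose degrees are one too small. Flipping a trail from
  s to t that alternates between non-edges and edges and starts and ends with a non-edge produces
  a realization of D, from which E is recovered if the trail is known. Hence the graphs with such a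
  trail on at most eight vertices contribute at most n^2 + n^4 + n^6 + n^8.

  Suppose that there is no such short trail. The neighbourhoods of a non-neighbour of s and of a
  non-neighbour of t, or one of the two, form together with s and t a clique X with more than
  \<delta> = d_n vertices. Call a vertex outside X poor if it has fewer than \<delta> neighbours in X. All
  neighbours of poor vertices outside X (the fringe) are joined to all of X. Since s, t \<in> X, the
  hypothesis on D leaves no room for X together with the fringe to be a clique, and a pair z, z' of
  non-adjacent fringe vertices lies on an alternating trail with ten vertices. These are too
  many to be counted by n^10, but applying the hypothesis once more to X and the fringe without
  z' shows that every E has at least m such trails, where m is the number of vertices that
  are joined to X. This set can be read off from the flipped graph and the eight vertices other
  than z and z', so that the trails have m^2 n^8 codes and the graphs number only m n^8 \<le> n^9.
*)
theory Submission
  imports Defs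
begin

section \<open>Poor vertices and the fringe of a clique\<close>

lemma int_card_Diff_singleton:
  assumes "finite L" "v \<in> L"
  shows "int (card (L - {v})) = int (card L) - 1"
  using card_Suc_Diff1[OF assms] by linarith

locale finite_graph =
  fixes V :: "'a set" and R :: "'a \<Rightarrow> 'a \<Rightarrow> bool"
  assumes finite_V: "finite V"
    and sym: "R x y \<Longrightarrow> R y x"
    and irrefl: "\<not> R x x"
    and in_V: "R x y \<Longrightarrow> x \<in> V"
begin

definition nbrs :: "'a \<Rightarrow> 'a set" where
  "nbrs v = {u. R v u}"

definition nonadj :: "'a \<Rightarrow> 'a \<Rightarrow> bool" where
  "nonadj x y \<longleftrightarrow> x \<in> V \<and> y \<in> V \<and> x \<noteq> y \<and> \<not> R x y"

definition joined :: "'a set \<Rightarrow> 'a set" where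
  "joined X = {v \<in> V - X. \<forall>y\<in>X. R v y}"

definition poor :: "int \<Rightarrow> 'a set \<Rightarrow> 'a set" where
  "poor \<delta> X = {c \<in> V - X. int (card (nbrs c \<inter> X)) < \<delta>}"

definition fringe :: "int \<Rightarrow> 'a set \<Rightarrow> 'a set" where
  "fringe \<delta> X = {z \<in> V - X. \<exists>c\<in>poor \<delta> X. R c z}"

text \<open>The possible middle parts of a trail with ten vertices: the non-edge \<open>z z'\<close>
  followed by the edge \<open>z' d\<close>. The poor vertex \<open>d\<close> is the exit, as it
  misses a vertex of the clique from which the trail can be completed.\<close>

definition triples :: "int \<Rightarrow> 'a set \<Rightarrow> ('a \<times> 'a \<times> 'a) set" where
  "triples \<delta> X = {(z, z', d). z \<in> fringe \<delta> X \<and> z' \<in> fringe \<delta> X \<and> nonadj z z'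
           \<and> d \<in> poor \<delta> X \<and> R d z'}"

lemma nbrs_subset: "nbrs v \<subseteq> V"
  using sym in_V by (auto simp: nbrs_def)

lemma finite_nbrs: "finite (nbrs v)"
  using nbrs_subset finite_V finite_subset by blast

lemma nonadj_sym: "nonadj x y \<Longrightarrow> nonadj y x"
  using sym by (auto simp: nonadj_def)

text \<open>Double counting. Summing over all of \<open>V\<close> lets each vertex contribute an
  amount bounded according to its position relative to \<open>K\<close>.\<close>

lemma sum_degree_eq:
  assumes "K \<subseteq> V"
  shows "(\<Sum>v\<in>K. int (card (nbrs v))) = (\<Sum>v\<in>V. int (card (nbrs v \<inter> K)))"
proof -
  have fK: "finite K" using assms finite_V finite_subset by blast
  have c: "int (card (nbrs v \<inter> S)) = (\<Sum>u\<in>S. of_bool (R v u))" if "finite S" for v S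
  proof -
    have "nbrs v \<inter> S = {u\<in>S. R v u}" by (auto simp: nbrs_def)
    then show ?thesis using that by (simp add: Int_def conj_commute)
  qed
  have "(\<Sum>v\<in>K. int (card (nbrs v))) = (\<Sum>v\<in>K. \<Sum>u\<in>V. of_bool (R v u))"
  proof (rule sum.cong)
    fix v show "int (card (nbrs v)) = (\<Sum>u\<in>V. of_bool (R v u))"
      using c[OF finite_V, of v] nbrs_subset[of v] by (simp add: Int_absorb2)
  qed simp
  also have "\<dots> = (\<Sum>u\<in>V. \<Sum>v\<in>K. of_bool (R v u))" by (rule sum.swap)
  also have "\<dots> = (\<Sum>u\<in>V. \<Sum>v\<in>K. of_bool (R u v))"
    by (intro sum.cong refl) (use sym in auto)
  also have "\<dots> = (\<Sum>v\<in>V. int (card (nbrs v \<inter> K)))"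
    using c[OF fK] by simp
  finally show ?thesis .
qed

text \<open>Moving a vertex of the fringe out of the set to which the capacity bound is applied
  shows that it has many poor neighbours unless there are many non-adjacent pairs.\<close>

lemma card_joined_le_triples:
  fixes \<delta> :: int
  assumes X: "X \<subseteq> V" and clique: "\<And>x y. x \<in> X \<Longrightarrow> y \<in> X \<Longrightarrow> x \<noteq> y \<Longrightarrow> R x y"
    and cardX: "\<delta> + 1 \<le> int (card X)"
    and deg: "\<And>v. v \<in> V - X \<Longrightarrow> \<delta> \<le> int (card (nbrs v))"
    and capacity: "\<And>K. X \<subseteq> K \<Longrightarrow> K \<subseteq> V \<Longrightarrow> (\<Sum>v\<in>K. int (card (nbrs v))) + 1
       \<le> int (card K) * (int (card K) - 1) + \<delta> * (int (card V) - int (card K))"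
    and full: "fringe \<delta> X \<subseteq> joined X"
  shows "joined X \<noteq> {} \<and> card (joined X) \<le> card (triples \<delta> X)" (is "_ \<and> _ \<le> card ?T")
proof -
  define C where "C = poor \<delta> X"
  define Z where "Z = fringe \<delta> X"
  define J where "J = joined X"
  \<comment> \<open>\<open>\<eta>\<close> is the number of ordered non-adjacent pairs in the fringe.
    These pairs are all that \<open>X \<union> Z\<close> lacks to be a clique.\<close>
  define \<nu> where "\<nu> v = card {z'\<in>Z. nonadj v z'}" for v
  define \<eta> where "\<eta> = (\<Sum>v\<in>Z. int (\<nu> v))"
  have Zsub: "Z \<subseteq> V - X" "Z \<subseteq> J" using full by (auto simp: Z_def fringe_def J_def)
  have fX: "finite X" and fZ: "finite Z" and fJ: "finite J"
    using X Zsub finite_V by (auto intro: finite_subset simp: J_def joined_def)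
  have Jsub: "J \<subseteq> V - X" by (auto simp: J_def joined_def)
  define x where "x = int (card X)"
  define y where "y = int (card Z)"
  have cardXZ: "int (card (X \<union> Z)) = x + y"
    unfolding x_def y_def using fX fZ Zsub by (subst card_Un_disjoint) auto
  have JX: "nbrs v \<inter> X = X" if "v \<in> J" for v using that by (auto simp: J_def joined_def nbrs_def)
  have C_nbrs: "nbrs c \<subseteq> X \<union> Z" if "c \<in> C" for c
    using that in_V sym by (auto simp: nbrs_def Z_def C_def fringe_def)
  have CJ: "C \<inter> J = {}"
    using JX cardX by (fastforce simp: C_def poor_def)
  have notC: "\<delta> \<le> int (card (nbrs v \<inter> X))" if "v \<in> V - X" "v \<notin> C" for v
    using that by (auto simp: C_def poor_def)
  have mono: "int (card (nbrs v \<inter> X)) \<le> int (card (nbrs v \<inter> L))" if "X \<subseteq> L" for v L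
    using that finite_nbrs by (auto intro!: card_mono)
  let ?K = "X \<union> Z"
  have inX: "int (card (nbrs v \<inter> L)) = int (card L) - 1" if "v \<in> X" "L \<subseteq> ?K" "v \<in> L" for v L
  proof -
    have "R v u" if "u \<in> L" "u \<noteq> v" for u
    proof (cases "u \<in> X")
      case False
      then show ?thesis using \<open>L \<subseteq> ?K\<close> \<open>u \<in> L\<close> \<open>v \<in> X\<close> Zsub sym
        by (auto simp: J_def joined_def)
    qed (use clique \<open>v \<in> X\<close> that in auto)
    then have "nbrs v \<inter> L = L - {v}"
      using irrefl by (auto simp: nbrs_def)
    moreover have "finite L" using that fX fZ finite_subset by blast
    ultimately show ?thesis using int_card_Diff_singleton[of L v] that by simp
  qed
  have inZ: "int (card (L - {v})) - int (\<nu> v) \<le> int (card (nbrs v \<inter> L))" if "v \<in> Z" "L \<subseteq> ?K" for v L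
  proof -
    have fL: "finite L" using that fX fZ finite_subset by blast
    have "L - {v} \<subseteq> (nbrs v \<inter> L) \<union> {z'\<in>Z. nonadj v z'}"
      using that Zsub by (auto simp: nbrs_def J_def joined_def nonadj_def)
    then have "card (L - {v}) \<le> card ((nbrs v \<inter> L) \<union> {z'\<in>Z. nonadj v z'})"
      using fL fZ by (intro card_mono) auto
    also have "\<dots> \<le> card (nbrs v \<inter> L) + \<nu> v" unfolding \<nu>_def by (rule card_Un_le)
    finally show ?thesis by simp
  qed
  have split: "(\<Sum>v\<in>V. g v) = (\<Sum>v\<in>X. g v) + (\<Sum>v\<in>Z. g v) + (\<Sum>v\<in>J - Z. g v) + (\<Sum>v\<in>V - X - J. g v)"
    for g :: "'a \<Rightarrow> int"
  proof -
    have "V = X \<union> (Z \<union> ((J - Z) \<union> (V - X - J)))" using X Zsub Jsub by auto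
    then have "(\<Sum>v\<in>V. g v) = (\<Sum>v\<in>X \<union> (Z \<union> ((J - Z) \<union> (V - X - J))). g v)" by simp
    also have "\<dots> = (\<Sum>v\<in>X. g v) + (\<Sum>v\<in>Z. g v) + (\<Sum>v\<in>J - Z. g v) + (\<Sum>v\<in>V - X - J. g v)"
      using fX fZ fJ finite_V Zsub Jsub by (subst sum.union_disjoint, (auto)[3])+ simp
    finally show ?thesis .
  qed
  have cards: "int (card V) = x + y + int (card (J - Z)) + int (card (V - X - J))"
    using split[of "\<lambda>_. 1"] by (simp add: x_def y_def)
  have Jpart: "(\<delta> + 1) * int (card (J - Z)) \<le> (\<Sum>v\<in>J - Z. int (card (nbrs v \<inter> L)))" if "X \<subseteq> L" for L
  proof -
    have "\<delta> + 1 \<le> int (card (nbrs v \<inter> L))" if "v \<in> J - Z" for v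
      using mono[OF \<open>X \<subseteq> L\<close>, of v] JX[of v] that cardX by auto
    then have "(\<Sum>v\<in>J - Z. \<delta> + 1) \<le> (\<Sum>v\<in>J - Z. int (card (nbrs v \<inter> L)))" by (intro sum_mono) auto
    then show ?thesis by (simp add: mult.commute)
  qed
  \<comment> \<open>The capacity bound for \<open>X \<union> Z\<close>: every outside vertex
    contributes at least \<delta>, those of \<open>J - Z\<close> at least \<delta> + 1, so the
    missing pairs inside must pay for this surplus and for the strictness.\<close>
  have eta_pos: "1 + int (card (J - Z)) \<le> \<eta>"
  proof -
    have "(\<Sum>v\<in>X. int (card (nbrs v \<inter> ?K))) = x * (x + y - 1)"
      using inX[of _ ?K] cardXZ by (simp add: x_def)
    moreover have "y * (x + y - 1) - \<eta> \<le> (\<Sum>v\<in>Z. int (card (nbrs v \<inter> ?K)))"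
    proof -
      have "(x + y - 1) - int (\<nu> v) \<le> int (card (nbrs v \<inter> ?K))" if "v \<in> Z" for v
        using inZ[OF that, of ?K] that fX fZ cardXZ int_card_Diff_singleton[of ?K v] by simp
      then have "(\<Sum>v\<in>Z. (x + y - 1) - int (\<nu> v)) \<le> (\<Sum>v\<in>Z. int (card (nbrs v \<inter> ?K)))"
        by (rule sum_mono)
      then show ?thesis by (simp add: sum_subtractf \<eta>_def y_def)
    qed
    moreover have "\<delta> * int (card (V - X - J)) \<le> (\<Sum>v\<in>V - X - J. int (card (nbrs v \<inter> ?K)))"
    proof -
      \<comment> \<open>A poor vertex has its whole neighbourhood in \<open>X \<union> Z\<close>;
        any other vertex has \<delta> neighbours in \<open>X\<close> alone.\<close>
      have "\<delta> \<le> int (card (nbrs v \<inter> ?K))" if v: "v \<in> V - X - J" for v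
      proof (cases "v \<in> C")
        case True
        then show ?thesis using C_nbrs[OF True] deg[of v] v by (simp add: Int_absorb2)
      next
        case False
        then show ?thesis using notC[of v] mono[of ?K v] v by auto
      qed
      then have "(\<Sum>v\<in>V - X - J. \<delta>) \<le> (\<Sum>v\<in>V - X - J. int (card (nbrs v \<inter> ?K)))" by (rule sum_mono)
      then show ?thesis by (simp add: mult.commute)
    qed
    moreover have "(\<Sum>v\<in>V. int (card (nbrs v \<inter> ?K))) + 1
        \<le> (x + y) * (x + y - 1) + \<delta> * (int (card V) - (x + y))"
      using capacity[of ?K] sum_degree_eq[of ?K] X Zsub cardXZ by auto
    ultimately show ?thesis
      using Jpart[of ?K] unfolding split[of "\<lambda>v. int (card (nbrs v \<inter> ?K))"] cards
      by (simp add: algebra_simps)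
  qed
  have "\<exists>z\<in>Z. \<nu> z \<noteq> 0"
  proof (rule ccontr)
    assume "\<not> ?thesis" then have "\<eta> = 0" by (simp add: \<eta>_def)
    then show False using eta_pos by simp
  qed
  then obtain z0 z1 where z: "z0 \<in> Z" "z1 \<in> Z" "nonadj z0 z1"
    by (auto simp: \<nu>_def card_gt_0_iff)
  define w where "w = card {d\<in>C. R d z1}"
  let ?L = "?K - {z1}"
  have XL: "X \<subseteq> ?L" using z Zsub by auto
  have cardL: "int (card ?L) = x + y - 1"
    using z fX fZ cardXZ int_card_Diff_singleton[of ?K z1] by simp
  \<comment> \<open>The same count without \<open>z1\<close>. Apart from the pairs missing in the
    fringe, only the poor neighbours of \<open>z1\<close> fall below their guaranteed contribution,
    by one each, which is what \<open>w\<close> counts.\<close>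
  have w: "int (card J) + 1 - \<eta> \<le> int w"
  proof -
    have "(\<Sum>v\<in>X. int (card (nbrs v \<inter> ?L))) = x * (x + y - 2)"
    proof -
      have "int (card (nbrs v \<inter> ?L)) = x + y - 2" if "v \<in> X" for v
        using inX[OF that, of ?L] cardL z Zsub that by auto
      then show ?thesis by (simp add: x_def)
    qed
    moreover have "y * (x + y - 2) + 1 - \<eta> \<le> (\<Sum>v\<in>Z. int (card (nbrs v \<inter> ?L)))"
    proof -
      \<comment> \<open>As \<open>z1\<close> is not in \<open>?L\<close>, nothing is subtracted for
        the vertex itself, which yields one extra unit.\<close>
      have "(x + y - 2) + of_bool (v = z1) - int (\<nu> v) \<le> int (card (nbrs v \<inter> ?L))" if "v \<in> Z" for v
      proof (cases "v = z1")
        case True then show ?thesis using inZ[OF that, of ?L] cardL by simp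
      next
        case False
        then have "v \<in> ?L" using that by auto
        then have "int (card (?L - {v})) = x + y - 2" using cardL fX fZ
          by (subst int_card_Diff_singleton) auto
        then show ?thesis using inZ[OF that, of ?L] False by auto
      qed
      then have "(\<Sum>v\<in>Z. (x + y - 2) + of_bool (v = z1) - int (\<nu> v)) \<le> (\<Sum>v\<in>Z. int (card (nbrs v \<inter> ?L)))"
        by (rule sum_mono)
      moreover have "(\<Sum>v\<in>Z. (of_bool (v = z1) :: int)) = 1" using z fZ by simp
      ultimately show ?thesis by (simp add: sum_subtractf sum.distrib \<eta>_def y_def)
    qed
    moreover have "\<delta> * int (card (V - X - J)) - int w \<le> (\<Sum>v\<in>V - X - J. int (card (nbrs v \<inter> ?L)))"
    proof -
      have "\<delta> - of_bool (v \<in> C \<and> R v z1) \<le> int (card (nbrs v \<inter> ?L))" if v: "v \<in> V - X - J" for v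
      proof (cases "v \<in> C")
        case True
        have "nbrs v \<subseteq> (nbrs v \<inter> ?L) \<union> (if R v z1 then {z1} else {})"
          using C_nbrs[OF True] by (auto simp: nbrs_def)
        then have "card (nbrs v) \<le> card ((nbrs v \<inter> ?L) \<union> (if R v z1 then {z1} else {}))"
          using finite_nbrs by (intro card_mono) auto
        also have "\<dots> \<le> card (nbrs v \<inter> ?L) + of_bool (R v z1)"
          by (rule order.trans[OF card_Un_le]) auto
        finally show ?thesis using deg[of v] v True by (auto split: if_splits)
      next
        case False
        then show ?thesis using notC[of v] mono[OF XL, of v] v by auto
      qed
      then have "(\<Sum>v\<in>V - X - J. \<delta> - of_bool (v \<in> C \<and> R v z1))
          \<le> (\<Sum>v\<in>V - X - J. int (card (nbrs v \<inter> ?L)))" by (rule sum_mono)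
      moreover have "(\<Sum>v\<in>V - X - J. (of_bool (v \<in> C \<and> R v z1) :: int)) = int w"
      proof -
        have "{v \<in> V - X - J. v \<in> C \<and> R v z1} = {d\<in>C. R d z1}"
          using CJ by (auto simp: C_def poor_def)
        then show ?thesis using finite_V by (simp add: w_def Int_def)
      qed
      ultimately show ?thesis by (simp add: sum_subtractf mult.commute)
    qed
    moreover have "(\<Sum>v\<in>V. int (card (nbrs v \<inter> ?L))) + 1
        \<le> (x + y - 1) * (x + y - 2) + \<delta> * (int (card V) - (x + y - 1))"
      using capacity[of ?L] sum_degree_eq[of ?L] X Zsub z cardL by fastforce
    moreover have "int (card J) = y + int (card (J - Z))"
      using card_Diff_subset[OF fZ Zsub(2)] card_mono[OF fJ Zsub(2)] by (simp add: y_def)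
    ultimately show ?thesis
      using Jpart[OF XL] cardX
      unfolding split[of "\<lambda>v. int (card (nbrs v \<inter> ?L))"] cards x_def[symmetric]
      by (simp add: algebra_simps)
  qed
  define M where "M = {(z, z'). z \<in> Z \<and> z' \<in> Z \<and> nonadj z z'}"
  have cardM: "int (card M) = \<eta>"
  proof -
    have "M = (SIGMA z:Z. {z'\<in>Z. nonadj z z'})" by (auto simp: M_def)
    then show ?thesis using fZ by (simp add: \<eta>_def \<nu>_def)
  qed
  have fM: "finite M" by (rule finite_subset[of _ "Z \<times> Z"]) (use fZ in \<open>auto simp: M_def\<close>)
  have fC: "finite C" using finite_V by (simp add: C_def poor_def)
  \<comment> \<open>The pair \<open>(z0, z1)\<close> extends to \<open>w\<close> triples, and each
    of the other \<eta> - 1 pairs to at least one since its second vertex lies in the fringe. With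
    the bound on \<open>w\<close> this reaches \<open>card J\<close>.\<close>
  define T where "T = (SIGMA m:M. {d\<in>C. R d (snd m)})"
  have "int (card T) = (\<Sum>m\<in>M. int (card {d\<in>C. R d (snd m)}))"
    using fM fC by (simp add: T_def)
  also have "\<dots> = int w + (\<Sum>m\<in>M - {(z0, z1)}. int (card {d\<in>C. R d (snd m)}))"
    using fM z by (subst sum.remove[of _ "(z0, z1)"]) (auto simp: M_def w_def)
  also have "\<dots> \<ge> int w + (\<Sum>m\<in>M - {(z0, z1)}. 1)"
  proof (intro add_left_mono sum_mono)
    fix m assume "m \<in> M - {(z0, z1)}"
    then have "\<exists>d. d \<in> C \<and> R d (snd m)" by (auto simp: M_def Z_def fringe_def C_def)
    then have "card {d\<in>C. R d (snd m)} \<noteq> 0" using fC by auto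
    then show "1 \<le> int (card {d\<in>C. R d (snd m)})" by linarith
  qed
  moreover have "(\<Sum>m\<in>M - {(z0, z1)}. 1) = \<eta> - 1"
    using int_card_Diff_singleton[OF fM, of "(z0, z1)"] cardM z by (auto simp: M_def)
  ultimately have "int (card J) \<le> int (card T)" using w by linarith
  moreover have "?T = (\<lambda>((z, z'), d). (z, z', d)) ` T"
    by (force simp: triples_def T_def M_def C_def Z_def)
  then have "card ?T = card T" 
    by (simp only:) (rule card_image, auto simp: inj_on_def)
  ultimately have "card J \<le> card ?T" by linarith
  moreover have "J \<noteq> {}" using z Zsub by auto
  ultimately show ?thesis by (simp add: J_def)
qed

text \<open>If \<open>clean x y a\<close> fails for a non-neighbour \<open>a\<close> of \<open>x\<close>, some neighbour of \<open>a\<close> is reached from \<open>x\<close>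
  both by an edge and by a non-edge, as in a blossom of matching theory.\<close>

definition clean :: "'a \<Rightarrow> 'a \<Rightarrow> 'a \<Rightarrow> bool" where
  "clean x y a \<longleftrightarrow> (\<forall>u\<in>nbrs a - {y}. R u x \<and> (\<forall>u'\<in>nbrs a - {y}. u \<noteq> u' \<longrightarrow> R u u'))"

text \<open>\<open>S\<close> collects known neighbours of \<open>c\<close> outside \<open>W\<close>,
  and \<open>F\<close> forbidden witnesses. Without a witness, \<open>c\<close> would have at least
  \<delta> - 1 - |F| + |S| \<ge> \<delta> neighbours in \<open>X\<close>.\<close>

lemma poor_misses:
  assumes c: "c \<in> poor \<delta> X" and "X \<subseteq> V" "W \<subseteq> X" "\<delta> - 1 \<le> int (card W)"
    and S: "S \<subseteq> X" "S \<inter> W = {}" "S \<subseteq> nbrs c" and F: "finite F" "card F < card S"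
  shows "\<exists>q\<in>W - F. nonadj c q"
proof (rule ccontr)
  assume "\<not> ?thesis"
  then have "W - F \<subseteq> nbrs c"
    using assms by (fastforce simp: nonadj_def nbrs_def poor_def)
  then have sub: "(W - F) \<union> S \<subseteq> nbrs c \<inter> X" using assms by auto
  have fX: "finite X" using assms finite_V finite_subset by blast
  have fW: "finite W" "finite S" using fX assms finite_subset by blast+
  have "card ((W - F) \<union> S) = card (W - F) + card S"
    using fW S by (subst card_Un_disjoint) auto
  moreover have "card W - card F \<le> card (W - F)"
    using F(1) by (rule diff_card_le_card_Diff)
  moreover have "card ((W - F) \<union> S) \<le> card (nbrs c \<inter> X)"
    using sub fX by (intro card_mono) auto
  ultimately have "\<delta> \<le> int (card (nbrs c \<inter> X))" using assms by linarith
  then show False using c by (simp add: poor_def)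
qed

lemma not_poor:
  assumes "S \<subseteq> nbrs v \<inter> X" "X \<subseteq> V" "\<delta> \<le> int (card S)"
  shows "v \<notin> poor \<delta> X"
proof -
  have "finite X" using assms finite_V finite_subset by blast
  then have "card S \<le> card (nbrs v \<inter> X)" using assms by (intro card_mono) auto
  then show ?thesis using assms by (auto simp: poor_def)
qed

lemma not_clean:
  assumes "\<not> clean x y a" "nonadj x a"
  shows "\<exists>u. R a u \<and> u \<noteq> y \<and> (nonadj x u \<or> (\<exists>u'. R a u' \<and> u' \<noteq> y \<and> nonadj u' u))"
proof -
  obtain u where u: "R a u" "u \<noteq> y" "\<not> R u x \<or> (\<exists>u'. R a u' \<and> u' \<noteq> y \<and> u \<noteq> u' \<and> \<not> R u u')"
    using assms(1) unfolding clean_def nbrs_def by blast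
  have V: "u \<in> V" "x \<in> V" using u sym in_V assms(2) by (auto simp: nonadj_def)
  have "u \<noteq> x" using u assms(2) sym by (auto simp: nonadj_def)
  then have "nonadj x u" if "\<not> R u x" using that V sym by (auto simp: nonadj_def)
  moreover have "nonadj u' u" if "R a u'" "u \<noteq> u'" "\<not> R u u'" for u'
    using that V sym[of a u'] sym[of u' u] in_V by (auto simp: nonadj_def)
  ultimately show ?thesis using u by blast
qed

end

section \<open>Graphs without an alternating trail on at most eight vertices\<close>

text \<open>The two deficient vertices \<open>s\<close> and \<open>t\<close> admit no trail with 2,
  4, 6 or 8 vertices. The side conditions of \<open>no_path7\<close> exclude sequences that use a
  step twice. In \<open>capacity\<close> the slack +1 of the degree hypothesis has become -1,
  because both deficient vertices lie in \<open>K\<close>.\<close>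

locale stuck = finite_graph +
  fixes s t :: 'a and \<delta> :: int
  assumes st: "R s t"
    and no_path3: "\<lbrakk>nonadj s a; R a b; nonadj b t\<rbrakk> \<Longrightarrow> False"
    and no_path5: "\<lbrakk>nonadj s a; R a u; nonadj u w; R w b; nonadj b t\<rbrakk> \<Longrightarrow> False"
    and no_path7: "\<lbrakk>nonadj s a; R a p; nonadj p c; R c x; nonadj x w; R w b; nonadj b t;
       w \<noteq> s \<or> x \<noteq> a; p \<noteq> t \<or> c \<noteq> b; a \<noteq> b \<or> p \<noteq> w\<rbrakk> \<Longrightarrow> False"
    and degree: "\<lbrakk>v \<in> V; v \<noteq> s; v \<noteq> t\<rbrakk> \<Longrightarrow> \<delta> \<le> int (card (nbrs v))"
    and capacity: "\<lbrakk>s \<in> K; t \<in> K; K \<subseteq> V\<rbrakk> \<Longrightarrow> (\<Sum>v\<in>K. int (card (nbrs v))) + 1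
       \<le> int (card K) * (int (card K) - 1) + \<delta> * (int (card V) - int (card K))"
begin

text \<open>Trails can be reversed, so each result about \<open>b\<close> and \<open>t\<close> has a
  mirror image about \<open>a\<close> and \<open>s\<close>.\<close>

lemma swap: "stuck V R t s \<delta>"
proof unfold_locales
  show "R t s" using st by (rule sym)
  show "\<lbrakk>nonadj t a; R a b; nonadj b s\<rbrakk> \<Longrightarrow> False" for a b
    using no_path3 nonadj_sym sym by blast
  show "\<lbrakk>nonadj t a; R a u; nonadj u w; R w b; nonadj b s\<rbrakk> \<Longrightarrow> False" for a b u w
    using no_path5 nonadj_sym sym by blast
  show "\<lbrakk>nonadj t a; R a p; nonadj p c; R c x; nonadj x w; R w b; nonadj b s;
       w \<noteq> t \<or> x \<noteq> a; p \<noteq> s \<or> c \<noteq> b; a \<noteq> b \<or> p \<noteq> w\<rbrakk> \<Longrightarrow> False" for a p c x w b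
    using no_path7[of b w x c p a] nonadj_sym sym by blast
qed (use degree capacity in auto)

lemma st_in_V: "s \<in> V" "t \<in> V" "s \<noteq> t"
  using st in_V sym irrefl by blast+

lemma start_neq: "nonadj s a \<Longrightarrow> a \<noteq> s \<and> a \<noteq> t" "nonadj b t \<Longrightarrow> b \<noteq> s \<and> b \<noteq> t"
  using st sym by (auto simp: nonadj_def)

text \<open>Otherwise \<open>s a u w b t\<close> is an alternating trail.\<close>

lemma nbrs_join:
  assumes "nonadj s a" "nonadj b t" "R a u" "R b w" "u \<noteq> w"
  shows "R u w"
  using no_path5[OF assms(1,3) _ sym[OF assms(4)] assms(2)] assms in_V sym
  unfolding nonadj_def by metis

text \<open>Otherwise \<open>s a u t\<close> is an alternating trail.\<close>

lemma nbr_of_start: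
  assumes "nonadj s a" "R a u" "u \<noteq> t"
  shows "R u t"
  using no_path3[OF assms(1,2)] assms in_V sym st_in_V unfolding nonadj_def by metis

lemma nbr_of_end:
  assumes "nonadj b t" "R b w" "w \<noteq> s"
  shows "R w s"
  using no_path3[OF _ sym[OF assms(2)] assms(1)] assms in_V sym st_in_V unfolding nonadj_def by metis

lemma card_nbrs_minus:
  assumes "v \<in> V" "v \<noteq> s" "v \<noteq> t"
  shows "\<delta> - 1 \<le> int (card (nbrs v - {y}))"
proof -
  have "card (nbrs v) - card {y} \<le> card (nbrs v - {y})"
    by (rule diff_card_le_card_Diff) simp
  then show ?thesis using degree[OF assms] by simp
qed

text \<open>If both fail, there are blossoms at \<open>u\<close> near \<open>s\<close> and at
  \<open>w\<close> near \<open>t\<close>. The edge \<open>u w\<close> then closes one of the trails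
  \<open>s u w t\<close>, \<open>s u w w' b t\<close>, \<open>s a u' u w t\<close>,
  \<open>s a u' u w w' b t\<close>.\<close>

lemma clean_start_or_end:
  assumes a: "nonadj s a" and b: "nonadj b t"
  shows "clean s t a \<or> clean t s b"
proof (rule ccontr)
  assume "\<not> ?thesis"
  then have na: "\<not> clean s t a" and nb: "\<not> clean t s b" by auto
  obtain u where u: "R a u" "u \<noteq> t" "nonadj s u \<or> (\<exists>u'. R a u' \<and> u' \<noteq> t \<and> nonadj u' u)"
    using not_clean[OF na a] by blast
  obtain w where w: "R b w" "w \<noteq> s" "nonadj w t \<or> (\<exists>w'. R b w' \<and> w' \<noteq> s \<and> nonadj w w')"
    using not_clean[OF nb nonadj_sym[OF b]] nonadj_sym by blast
  have "u \<noteq> w"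
    using u w no_path3[OF _ _ b] no_path3[OF a] nbrs_join[OF a b] sym unfolding nonadj_def by metis
  then have uw: "R u w" using nbrs_join[OF a b] u w by blast
  show False using u(3) w(3)
  proof (elim disjE exE conjE)
    assume "nonadj s u" "nonadj w t" then show False using no_path3 uw by blast
  next
    fix w' assume "nonadj s u" "R b w'" "nonadj w w'" then show False
      using no_path5 uw b sym by blast
  next
    fix u' assume "nonadj w t" "R a u'" "nonadj u' u" then show False
      using no_path5 uw a sym by blast
  next
    fix u' w' assume u': "R a u'" "u' \<noteq> t" "nonadj u' u" and w': "R b w'" "w' \<noteq> s" "nonadj w w'"
    have "u' \<noteq> w'" using nbrs_join[OF a b u(1) w'(1)] u' sym unfolding nonadj_def by metis
    then show False using no_path7[OF a u'(1,3) uw w'(3) sym[OF w'(1)] b] u' w' by blast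
  qed
qed

end

text \<open>The sequence \<open>x a p u z z' d q b y\<close> is the trail; the inequalities and the position relative
  to \<open>X\<close> ensure that no edge or non-edge is used twice.\<close>

definition (in finite_graph) detour where
  "detour X x y a p u z z' d q b \<longleftrightarrow> nonadj x a \<and> R a p \<and> nonadj p u \<and> R u z \<and> nonadj z z' \<and> R z' d
     \<and> nonadj d q \<and> R q b \<and> nonadj b y \<and> x \<in> X \<and> y \<in> X \<and> q \<in> X \<and> x \<noteq> y \<and> q \<noteq> x \<and> q \<noteq> y
     \<and> p \<noteq> x \<and> p \<noteq> y \<and> p \<noteq> q \<and> a \<notin> X \<and> u \<notin> X \<and> z \<notin> X \<and> z' \<notin> X \<and> d \<notin> X \<and> b \<notin> X
     \<and> u \<noteq> z' \<and> a \<noteq> d \<and> p \<noteq> d \<and> b \<noteq> u \<and> b \<noteq> z \<and> b \<noteq> z' \<and> b \<noteq> d"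

context stuck
begin

text \<open>The set \<open>nbrs b - {s}\<close> has at least \<delta> - 1 vertices, and the
  neighbour \<open>t\<close> of \<open>c\<close> lies outside it, so a poor \<open>c\<close> cannot
  be adjacent to all of it. If \<open>s\<close> is a neighbour as well, there is room to avoid one
  vertex \<open>y\<close>. The witness \<open>q\<close> continues a trail from \<open>c\<close> by
  \<open>q b t\<close>.\<close>

lemma poor_misses_end:
  assumes b: "nonadj b t" and X: "X \<subseteq> V" "nbrs b - {s} \<subseteq> X" "s \<in> X" "t \<in> X"
    and c: "c \<in> poor \<delta> X" "R c t"
  shows "\<exists>q. R b q \<and> q \<noteq> s \<and> nonadj c q"
    and "R c s \<Longrightarrow> \<exists>q. R b q \<and> q \<noteq> s \<and> nonadj c q \<and> q \<noteq> y"
proof -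
  have W: "\<delta> - 1 \<le> int (card (nbrs b - {s}))"
    using card_nbrs_minus[of b s] b start_neq by (auto simp: nonadj_def)
  have t: "t \<notin> nbrs b" using b by (auto simp: nbrs_def nonadj_def)
  show "\<exists>q. R b q \<and> q \<noteq> s \<and> nonadj c q"
    using poor_misses[OF c(1) X(1,2) W, of "{t}" "{}"] X c t by (auto simp: nbrs_def)
  show "\<exists>q. R b q \<and> q \<noteq> s \<and> nonadj c q \<and> q \<noteq> y" if "R c s"
    using poor_misses[OF c(1) X(1,2) W, of "{s, t}" "{y}"] X c t that st_in_V by (auto simp: nbrs_def)
qed

lemma end_not_poor:
  assumes b: "nonadj b t" and X: "X \<subseteq> V" "nbrs b \<subseteq> X"
  shows "b \<notin> poor \<delta> X"
  using not_poor[of "nbrs b" b X \<delta>] degree[of b] start_neq b X by (auto simp: nonadj_def)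

text \<open>Otherwise \<open>s c z z' d t\<close> or \<open>s c z z' d q b t\<close> is an
  alternating trail, with \<open>q\<close> a neighbour of \<open>b\<close> missed by
  \<open>d\<close>.\<close>

lemma poor_adj_start:
  assumes b: "nonadj b t" and X: "X \<subseteq> V" "nbrs b \<subseteq> X" "s \<in> X" "t \<in> X"
    and cd: "c \<in> poor \<delta> X" "d \<in> poor \<delta> X" "R c z" "R d z'" "nonadj z z'" "z \<notin> X" "z' \<notin> X"
  shows "R c s"
proof (rule ccontr)
  assume "\<not> R c s"
  then have c: "nonadj s c" using cd X sym by (auto simp: nonadj_def poor_def)
  show False
  proof (cases "R d t")
    case True
    then obtain q where "R b q" "q \<noteq> s" "nonadj d q"
      using poor_misses_end(1)[OF b X(1) _ X(3,4) cd(2)] X by blast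
    then show False
      using no_path7[OF c cd(3,5) sym[OF cd(4)] _ _ b] sym end_not_poor[OF b X(1,2)] cd X by metis
  next
    case False
    then have "nonadj d t" using cd X by (auto simp: nonadj_def poor_def)
    then show False using no_path5[OF c cd(3,5) sym[OF cd(4)]] by blast
  qed
qed

text \<open>Otherwise \<open>s z c t\<close> or \<open>s z c q b t\<close> is an alternating
  trail.\<close>

lemma fringe_adj_start:
  assumes b: "nonadj b t" and X: "X \<subseteq> V" "nbrs b - {s} \<subseteq> X" "s \<in> X" "t \<in> X"
    and c: "c \<in> poor \<delta> X" "R c z" "z \<notin> X"
  shows "R z s"
proof (rule ccontr)
  assume "\<not> R z s"
  then have z: "nonadj s z" using c X in_V[OF sym[OF c(2)]] sym by (auto simp: nonadj_def)
  show False
  proof (cases "R c t")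
    case True
    then obtain q where "R b q" "q \<noteq> s" "nonadj c q"
      using poor_misses_end(1)[OF b X c(1)] by blast
    then show False using no_path5[OF z sym[OF c(2)] _ _ b] sym by blast
  next
    case False
    then have "nonadj c t" using c X by (auto simp: nonadj_def poor_def)
    then show False using no_path3[OF z sym[OF c(2)]] by blast
  qed
qed

text \<open>A non-edge \<open>z y\<close> gives the trail \<open>s c z y b t\<close> if
  \<open>c\<close> misses \<open>s\<close>. If not, \<open>c\<close> misses a neighbour
  \<open>p\<close> of \<open>a\<close>, and \<open>s a p c z y b t\<close> is the candidate.\<close>

lemma clean_fringe_adj:
  assumes a: "nonadj s a" and b: "nonadj b t" and X: "X = nbrs a \<union> nbrs b \<union> {s, t}"
    and c: "c \<in> poor \<delta> X" "R c z" "z \<notin> X" and y: "R b y" "y \<noteq> s"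
  shows "R z y"
proof (rule ccontr)
  assume "\<not> R z y"
  then have zy: "nonadj z y" using c X y sym in_V by (auto simp: nonadj_def nbrs_def)
  have XV: "X \<subseteq> V" using X nbrs_subset st_in_V by auto
  have cX: "c \<in> V" "c \<notin> X" using c by (auto simp: poor_def)
  interpret sw: stuck V R t s \<delta> by (rule swap)
  have a': "nonadj a s" using a by (rule nonadj_sym)
  show False
  proof (cases "R c s")
    case False
    then have "nonadj s c" using c X sym st_in_V by (auto simp: nonadj_def poor_def)
    then show False using no_path5[OF _ c(2) zy sym[OF y(1)] b] by blast
  next
    case True
    show False
    proof (cases "R c t")
      case False
      then have ct: "nonadj c t" using cX X st_in_V by (auto simp: nonadj_def)
      obtain p where p: "R a p" "p \<noteq> t" "nonadj c p"
        using sw.poor_misses_end(1)[OF a' XV _ _ _ c(1) True] X by blast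
      show False
      proof (cases "a = b \<and> p = y")
        \<comment> \<open>Here the edge \<open>a p\<close> would be used twice; the trail
          \<open>s a y z c t\<close> takes over.\<close>
        case True
        then show False using no_path5[OF a p(1) _ sym[OF c(2)] ct] zy nonadj_sym by blast
      next
        case False
        then show False
          using no_path7[OF a p(1) nonadj_sym[OF p(3)] c(2) zy sym[OF y(1)] b] y p by blast
      qed
    next
      case ct: True
      obtain p where p: "R a p" "p \<noteq> t" "nonadj c p" "p \<noteq> y"
        using sw.poor_misses_end(2)[OF a' XV _ _ _ c(1) True ct, of y] X by blast
      then show False
        using no_path7[OF a p(1) nonadj_sym[OF p(3)] c(2) zy sym[OF y(1)] b] y by blast
    qed
  qed
qed

lemma card_clique_ge:
  assumes b: "nonadj b t" and X: "X \<subseteq> V" "nbrs b - {s} \<subseteq> X" "s \<in> X" "t \<in> X"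
  shows "\<delta> + 1 \<le> int (card X)"
proof -
  have fX: "finite X" using X finite_V finite_subset by blast
  have t: "t \<notin> nbrs b" using b by (auto simp: nbrs_def nonadj_def)
  have "card ((nbrs b - {s}) \<union> {s, t}) = card (nbrs b - {s}) + 2"
    using finite_nbrs t st_in_V by (subst card_Un_disjoint) auto
  moreover have "card ((nbrs b - {s}) \<union> {s, t}) \<le> card X" using X fX by (intro card_mono) auto
  moreover have "\<delta> - 1 \<le> int (card (nbrs b - {s}))"
    using card_nbrs_minus[of b s] b start_neq by (auto simp: nonadj_def)
  ultimately show ?thesis by linarith
qed

lemma joined_triples:
  assumes b: "nonadj b t" and X: "X \<subseteq> V" "nbrs b - {s} \<subseteq> X" "s \<in> X" "t \<in> X"
    and clique: "\<And>x y. x \<in> X \<Longrightarrow> y \<in> X \<Longrightarrow> x \<noteq> y \<Longrightarrow> R x y"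
    and full: "fringe \<delta> X \<subseteq> joined X"
  shows "joined X \<noteq> {} \<and> card (joined X) \<le> card (triples \<delta> X)"
proof (rule card_joined_le_triples[OF X(1) clique card_clique_ge[OF b X] _ _ full])
  fix v assume "v \<in> V - X" then show "\<delta> \<le> int (card (nbrs v))" using degree[of v] X by auto
next
  fix K assume "X \<subseteq> K" "K \<subseteq> V"
  then show "(\<Sum>v\<in>K. int (card (nbrs v))) + 1
       \<le> int (card K) * (int (card K) - 1) + \<delta> * (int (card V) - int (card K))"
    using capacity[of K] X by auto
qed

lemma joined_not_poor:
  assumes "\<delta> + 1 \<le> int (card X)" "v \<in> joined X"
  shows "v \<notin> poor \<delta> X"
proof -
  have "nbrs v \<inter> X = X" using assms(2) by (auto simp: joined_def nbrs_def)
  then show ?thesis using assms(1) by (simp add: poor_def)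
qed

section \<open>Trails with ten vertices through the fringe\<close>

text \<open>\<open>X\<close> is a clique: cleanness gives the edges within each neighbourhood,
  \<open>nbrs_join\<close> those between the two. The trail leaves \<open>s\<close> through
  \<open>a\<close> and a vertex \<open>p\<close> missed by the poor neighbour of \<open>z\<close>,
  and reaches \<open>t\<close> through a vertex \<open>q\<close> missed by \<open>d\<close>.\<close>

lemma clean_detours:
  assumes a: "nonadj s a" and b: "nonadj b t" and cl: "clean s t a" "clean t s b"
    and X: "X = nbrs a \<union> nbrs b \<union> {s, t}"
  shows "joined X \<noteq> {} \<and> card (joined X) \<le> card (triples \<delta> X)"
    and "(z, z', d) \<in> triples \<delta> X \<Longrightarrow> z \<in> joined X \<and> z' \<in> joined X \<and>
      (\<exists>p u q. detour X s t a p u z z' d q b \<and> p \<in> X \<and> a \<noteq> u \<and> a \<noteq> z \<and> a \<noteq> z')"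
proof -
  interpret sw: stuck V R t s \<delta> by (rule swap)
  have a': "nonadj a s" and b': "nonadj t b" using a b by (auto intro: nonadj_sym)
  have XV: "X \<subseteq> V" using X nbrs_subset st_in_V by auto
  have mem: "x \<in> X \<longleftrightarrow> R a x \<or> R b x \<or> x = s \<or> x = t" for x using X by (auto simp: nbrs_def)
  have nas: "\<not> R a s" "\<not> R s a" and nbt: "\<not> R b t" "\<not> R t b"
    using a b sym by (auto simp: nonadj_def)
  have clique: "R x y" if "x \<in> X" "y \<in> X" "x \<noteq> y" for x y
  proof -
    have A: "R x y" if "R a x" "x \<noteq> t" "R a y \<or> R b y \<or> y = s \<or> y = t" "x \<noteq> y" for x y
      using that cl(1) nbrs_join[OF a b] nbr_of_start[OF a] nas unfolding clean_def nbrs_def by blast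
    have B: "R x y" if "R b x" "x \<noteq> s" "R a y \<or> R b y \<or> y = s \<or> y = t" "x \<noteq> y" for x y
      using that cl(2) nbrs_join[OF a b] nbr_of_end[OF b] nbt sym unfolding clean_def nbrs_def by blast
    show ?thesis
      using that A[of x y] A[of y x] B[of x y] B[of y x] st sym mem by metis
  qed
  have W: "nbrs b - {s} \<subseteq> X" "nbrs b \<subseteq> X" "nbrs a - {t} \<subseteq> X" "nbrs a \<subseteq> X" "s \<in> X" "t \<in> X"
    using X by auto
  have full: "fringe \<delta> X \<subseteq> joined X"
  proof
    fix z assume "z \<in> fringe \<delta> X"
    then obtain c where z: "z \<in> V - X" and c: "c \<in> poor \<delta> X" "R c z" by (auto simp: fringe_def)
    have "R z y" if "y \<in> X" for y
    proof -
      have X': "X = nbrs b \<union> nbrs a \<union> {t, s}" using X by auto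
      show ?thesis
        using that clean_fringe_adj[OF a b X c, of y] sw.clean_fringe_adj[OF b' a' X' c, of y]
          fringe_adj_start[OF b XV W(1,5,6) c] sw.fringe_adj_start[OF a' XV W(3,6,5) c] z mem
        by blast
    qed
    then show "z \<in> joined X" using z by (auto simp: joined_def)
  qed
  show "joined X \<noteq> {} \<and> card (joined X) \<le> card (triples \<delta> X)"
    using joined_triples[OF b XV W(1,5,6) clique full] .
  show "z \<in> joined X \<and> z' \<in> joined X \<and>
      (\<exists>p u q. detour X s t a p u z z' d q b \<and> p \<in> X \<and> a \<noteq> u \<and> a \<noteq> z \<and> a \<noteq> z')"
    if tr: "(z, z', d) \<in> triples \<delta> X"
  proof -
    have J: "z \<in> joined X" "z' \<in> joined X" and d: "d \<in> poor \<delta> X" "R d z'" and zz: "nonadj z z'"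
      using tr full by (auto simp: triples_def)
    obtain c where c: "c \<in> poor \<delta> X" "R c z" using tr by (auto simp: triples_def fringe_def)
    have zX: "z \<notin> X" "z' \<notin> X" using J by (auto simp: joined_def)
    have z'z: "nonadj z' z" using zz by (rule nonadj_sym)
    have cs: "R c s" and ds: "R d s" and ct: "R c t" and dt: "R d t"
      using poor_adj_start[OF b XV W(2,5,6) c(1) d(1) c(2) d(2) zz zX]
        poor_adj_start[OF b XV W(2,5,6) d(1) c(1) d(2) c(2) z'z zX(2,1)]
        sw.poor_adj_start[OF a' XV W(4,6,5) c(1) d(1) c(2) d(2) zz zX]
        sw.poor_adj_start[OF a' XV W(4,6,5) d(1) c(1) d(2) c(2) z'z zX(2,1)] by auto
    obtain q where q: "R b q" "q \<noteq> s" "nonadj d q"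
      using poor_misses_end(1)[OF b XV W(1,5,6) d(1) dt] by blast
    \<comment> \<open>Both \<open>s\<close> and \<open>t\<close> are adjacent to \<open>c\<close>,
      so \<open>p\<close> can be chosen different from the vertex \<open>q\<close> fixed
      before.\<close>
    obtain p where p: "R a p" "p \<noteq> t" "nonadj c p" "p \<noteq> q"
      using sw.poor_misses_end(2)[OF a' XV W(3,6,5) c(1) cs ct, of q] by blast
    have notp: "a \<notin> poor \<delta> X" "b \<notin> poor \<delta> X"
      using end_not_poor[OF b XV W(2)] sw.end_not_poor[OF a' XV W(4)] by auto
    have jp: "z \<notin> poor \<delta> X" "z' \<notin> poor \<delta> X"
      using joined_not_poor[OF card_clique_ge[OF b XV W(1,5,6)]] J by auto
    have zs: "R z s" "R z t" "R z' s" "R z' t" using J W by (auto simp: joined_def)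
    have nba: "\<not> R b a" "\<not> R a b" using no_path3[OF a _ b] sym by blast+
    have "a \<notin> X" "b \<notin> X" using nba irrefl start_neq(1)[OF a] start_neq(2)[OF b] mem by auto
    moreover have "c \<notin> X" "d \<notin> X" using c d by (auto simp: poor_def)
    moreover have "p \<in> X" "q \<in> X" using mem p q by auto
    moreover have "p \<noteq> s" "p \<noteq> d" "q \<noteq> t" "a \<noteq> d" "a \<noteq> c" "b \<noteq> c" "b \<noteq> d" "c \<noteq> z'"
      "a \<noteq> z" "a \<noteq> z'" "b \<noteq> z" "b \<noteq> z'"
      using nas p q nbt notp c d jp zs calculation by auto
    ultimately have "detour X s t a p c z z' d q b"
      unfolding detour_def using a b p q c d(2) zz zX st_in_V W(5,6) sym[OF d(2)] sym[OF q(1)]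
        nonadj_sym[OF p(3)] by simp
    then have "detour X s t a p c z z' d q b \<and> p \<in> X \<and> a \<noteq> c \<and> a \<noteq> z \<and> a \<noteq> z'"
      using \<open>p \<in> X\<close> \<open>a \<noteq> c\<close> \<open>a \<noteq> z\<close> \<open>a \<noteq> z'\<close> by simp
    then show ?thesis using J by blast
  qed
qed

text \<open>The neighbourhood of \<open>a\<close> need not be a clique, so \<open>X\<close> is built
  from \<open>b\<close> alone. Instead, the blossom vertex \<open>u\<close> takes the place of the
  poor neighbour of \<open>z\<close> in the trail.\<close>

lemma blossom_detours:
  assumes a: "nonadj s a" and b: "nonadj b t" and cl: "\<not> clean s t a" "clean t s b"
    and X: "X = nbrs b \<union> {s, t}"
  shows "joined X \<noteq> {} \<and> card (joined X) \<le> card (triples \<delta> X)"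
    and "(z, z', d) \<in> triples \<delta> X \<Longrightarrow> z \<in> joined X \<and> z' \<in> joined X \<and>
      (\<exists>p u q. detour X s t a p u z z' d q b \<and> b \<noteq> a \<and> b \<noteq> p)"
proof -
  have XV: "X \<subseteq> V" using X nbrs_subset st_in_V by auto
  have mem: "x \<in> X \<longleftrightarrow> R b x \<or> x = s \<or> x = t" for x using X by (auto simp: nbrs_def)
  have nas: "\<not> R a s" "\<not> R s a" and nbt: "\<not> R b t" "\<not> R t b"
    using a b sym by (auto simp: nonadj_def)
  have W: "nbrs b - {s} \<subseteq> X" "nbrs b \<subseteq> X" "s \<in> X" "t \<in> X" using X by auto
  have clique: "R x y" if "x \<in> X" "y \<in> X" "x \<noteq> y" for x y
  proof -
    have B: "R x y" if "R b x" "x \<noteq> s" "R b y \<or> y = s \<or> y = t" "x \<noteq> y" for x y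
      using that cl(2) nbr_of_end[OF b] nbt sym unfolding clean_def nbrs_def by blast
    show ?thesis using that B[of x y] B[of y x] st sym mem by metis
  qed
  \<comment> \<open>From \<open>s\<close>, the vertex \<open>u\<close> is reached by an edge via
    \<open>s a u\<close>, and by a non-edge via \<open>s u\<close> or
    \<open>s a u' u\<close>.\<close>
  obtain u where u: "R a u" "u \<noteq> t" and odd: "nonadj s u \<or> (\<exists>u'. R a u' \<and> u' \<noteq> t \<and> nonadj u' u)"
    using not_clean[OF cl(1) a] by blast
  have ab: "a \<noteq> b"
    using odd no_path3[OF _ sym[OF u(1)]] nbrs_join[OF a _ _ u(1)] b unfolding nonadj_def by metis
  have odd_end: "\<not> R u w" if "nonadj w t" for w
    using odd no_path3 no_path5[OF a] that by blast
  \<comment> \<open>Prolonging the approach to \<open>u\<close> that ends in a non-edge gives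
    \<open>s u x y w t\<close> or \<open>s a u' u x y w t\<close>; the two inequalities prevent
    repeated steps.\<close>
  have odd_path: False if "R u x" "nonadj x y" "R y w" "nonadj w t" "w \<noteq> a" "y \<noteq> s" for x y w
    using odd no_path5[OF _ that(1-4)] no_path7[OF a _ _ that(1-4)] that by blast
  have ut: "R u t" using nbr_of_start[OF a u] .
  have uX: "u \<notin> X" using odd_end[OF b] mem sym[of b u] u nas by auto
  have Wt: "\<delta> \<le> int (card ((nbrs b - {s}) \<union> {t}))"
  proof -
    have "card ((nbrs b - {s}) \<union> {t}) = card (nbrs b - {s}) + 1"
      using finite_nbrs nbt by (subst card_Un_disjoint) (auto simp: nbrs_def)
    then show ?thesis using card_nbrs_minus[of b s] b start_neq by (auto simp: nonadj_def)
  qed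
  \<comment> \<open>By \<open>nbrs_join\<close> and \<open>nbr_of_start\<close>, such a
    \<open>v\<close> is adjacent to \<open>t\<close> and to all of \<open>nbrs b - {s}\<close>. This
    later keeps \<open>p\<close> apart from \<open>d\<close>.\<close>
  have side_not_poor: "v \<notin> poor \<delta> X" if v: "R a v" "v \<noteq> t" "\<not> R b v" for v
  proof (rule not_poor[OF _ XV Wt])
    show "nbrs b - {s} \<union> {t} \<subseteq> nbrs v \<inter> X"
      using nbrs_join[OF a b v(1)] nbr_of_start[OF a v(1,2)] v(3) W by (auto simp: nbrs_def)
  qed
  have unp: "u \<notin> poor \<delta> X" using side_not_poor[OF u] uX mem by auto
  have bnp: "b \<notin> poor \<delta> X" using end_not_poor[OF b XV W(2)] .
  \<comment> \<open>An edge \<open>u c\<close> would prolong the approach to \<open>u\<close> by a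
    non-edge, and a non-edge \<open>u z\<close> the approach \<open>s a u\<close>. Either way
    \<open>c\<close> leads on to \<open>t\<close>, directly or via \<open>q b\<close>.\<close>
  have odd_poor: "\<not> R u c" "R c z \<Longrightarrow> R u z \<and> z \<noteq> u"
    if c: "c \<in> poor \<delta> X" "R c s" for c z
  proof -
    have cV: "c \<in> V" "c \<notin> X" using c by (auto simp: poor_def)
    show nuc: "\<not> R u c"
    proof (cases "R c t")
      case True
      then obtain q where "R b q" "q \<noteq> s" "nonadj c q"
        using poor_misses_end(1)[OF b XV W(1,3,4) c(1)] by blast
      then show ?thesis using odd_path[OF _ _ _ b] sym ab by metis
    next
      case False
      then show ?thesis using odd_end cV W st_in_V by (auto simp: nonadj_def)
    qed
    show "R u z \<and> z \<noteq> u" if z: "R c z"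
    proof (rule ccontr)
      assume neg: "\<not> ?thesis"
      have "z \<noteq> u" using nuc z sym by blast
      then have uz: "nonadj u z" using neg z sym u in_V by (metis nonadj_def)
      show False
      proof (cases "R c t")
        case True
        then obtain q where "R b q" "q \<noteq> s" "nonadj c q"
          using poor_misses_end(1)[OF b XV W(1,3,4) c(1)] by blast
        then show ?thesis using no_path7[OF a u(1) uz sym[OF z] _ _ b] u ab sym by blast
      next
        case False
        then have "nonadj c t" using cV W st_in_V by (auto simp: nonadj_def)
        then show ?thesis using no_path5[OF a u(1) uz sym[OF z]] by blast
      qed
    qed
  qed
  \<comment> \<open>If \<open>c\<close> misses \<open>s\<close>, a missing edge \<open>z y\<close>
    with \<open>y\<close> other than \<open>s\<close> completes a trail starting
    \<open>s c z y\<close>. Otherwise \<open>u z\<close> is an edge and the trail goes through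
    \<open>u\<close> instead.\<close>
  have full: "fringe \<delta> X \<subseteq> joined X"
  proof
    fix z assume "z \<in> fringe \<delta> X"
    then obtain c where z: "z \<in> V - X" and c: "c \<in> poor \<delta> X" "R c z" by (auto simp: fringe_def)
    have cV: "c \<in> V" "c \<notin> X" using c by (auto simp: poor_def)
    have nsc: "nonadj s c" if "\<not> R c s" using that cV W sym st_in_V by (auto simp: nonadj_def)
    have "R z y" if y: "y \<in> X" for y
    proof (rule ccontr)
      assume "\<not> R z y"
      then have zy: "nonadj z y" using z y XV by (auto simp: nonadj_def)
      consider "y = s" | "y = t" | "R b y" "y \<noteq> s" using y mem by blast
      then show False
      proof cases
        case 1
        then show ?thesis using fringe_adj_start[OF b XV W(1,3,4) c] z \<open>\<not> R z y\<close> by blast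
      next
        case 2
        then show ?thesis using no_path3[OF nsc c(2)] zy odd_poor(2)[OF c(1) _ c(2)] odd_end by blast
      next
        case 3
        then show ?thesis
          using no_path5[OF nsc c(2) zy sym[OF 3(1)] b] odd_poor(2)[OF c(1) _ c(2)]
            odd_path[OF _ zy sym[OF 3(1)] b] ab by blast
      qed
    qed
    then show "z \<in> joined X" using z by (auto simp: joined_def)
  qed
  show "joined X \<noteq> {} \<and> card (joined X) \<le> card (triples \<delta> X)"
    using joined_triples[OF b XV W(1,3,4) clique full] .
  show "z \<in> joined X \<and> z' \<in> joined X \<and>
      (\<exists>p u q. detour X s t a p u z z' d q b \<and> b \<noteq> a \<and> b \<noteq> p)"
    if tr: "(z, z', d) \<in> triples \<delta> X"
  proof -
    have J: "z \<in> joined X" "z' \<in> joined X" and d: "d \<in> poor \<delta> X" "R d z'" and zz: "nonadj z z'"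
      using tr full by (auto simp: triples_def)
    obtain c where c: "c \<in> poor \<delta> X" "R c z" using tr by (auto simp: triples_def fringe_def)
    have zX: "z \<notin> X" "z' \<notin> X" using J by (auto simp: joined_def)
    have dV: "d \<in> V" "d \<notin> X" using d by (auto simp: poor_def)
    have z'z: "nonadj z' z" using zz by (rule nonadj_sym)
    have zs: "R z s" "R z t" "R z' s" "R z' t" using J W by (auto simp: joined_def)
    have cs: "R c s" and ds: "R d s"
      using poor_adj_start[OF b XV W(2-4) c(1) d(1) c(2) d(2) zz zX]
        poor_adj_start[OF b XV W(2-4) d(1) c(1) d(2) c(2) z'z zX(2,1)] by auto
    have uz: "R u z" "z \<noteq> u" "z' \<noteq> u"
      using odd_poor(2)[OF c(1) cs c(2)] odd_poor(2)[OF d(1) ds d(2)] by auto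
    have ad: "a \<noteq> d" using ds nas by auto
    have dt: "R d t"
    proof (rule ccontr)
      assume "\<not> R d t"
      then have "nonadj d t" using dV W st_in_V by (auto simp: nonadj_def)
      then show False using odd_path[OF uz(1) zz sym[OF d(2)]] ad zX W by blast
    qed
    obtain q where q: "R b q" "q \<noteq> s" "nonadj d q"
      using poor_misses_end(1)[OF b XV W(1,3,4) d(1) dt] by blast
    have ub: "u \<noteq> b" using ut nbt by auto
    \<comment> \<open>Otherwise \<open>s u z z' d q b t\<close> is a trail with eight vertices.
      Hence the non-edge at \<open>u\<close> comes from a second neighbour \<open>p\<close> of
      \<open>a\<close>.\<close>
    have "\<not> nonadj s u"
      using no_path7[OF _ uz(1) zz sym[OF d(2)] q(3) sym[OF q(1)] b] q(2) zX W ub by blast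
    then obtain p where p: "R a p" "p \<noteq> t" "nonadj p u" using odd by blast
    have bp: "\<not> R b p" using nbrs_join[OF a b u(1), of p] p nonadj_sym[OF p(3)]
      unfolding nonadj_def by metis
    have "p \<notin> poor \<delta> X" using side_not_poor[OF p(1,2) bp] .
    then have pd: "p \<noteq> d" using d by auto
    have "R p t" using nbr_of_start[OF a p(1,2)] .
    then have "b \<noteq> p" using nbt by auto
    have nba: "\<not> R b a" using no_path3[OF a _ b] sym by blast
    have "a \<notin> X" "b \<notin> X" using nba irrefl start_neq(1)[OF a] start_neq(2)[OF b] mem by auto
    moreover have "q \<in> X" "p \<noteq> q" "p \<noteq> s" "q \<noteq> t" "b \<noteq> d" "b \<noteq> z" "b \<noteq> z'"
      using q bp mem nas p nbt bnp d zs by auto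
    ultimately have "detour X s t a p u z z' d q b"
      unfolding detour_def using a b p q d(2) zz zX uX uz dV ad pd ub st_in_V W(3,4) sym[OF d(2)] sym[OF q(1)]
      by simp
    then show ?thesis using J ab \<open>b \<noteq> p\<close> by blast
  qed
qed

end

section \<open>Flipping alternating trails\<close>

text \<open>Each step is tested in the graph as changed by the earlier flips, so flipping can be
  analysed one pair of steps at a time. The last step must be a non-edge, which makes the number of
  vertices even.\<close>

fun alternating :: "nat set set \<Rightarrow> nat list \<Rightarrow> bool" where
  "alternating E (x # y # z # r) \<longleftrightarrow> x \<noteq> y \<and> {x, y} \<notin> E \<and> {y, z} \<in> E
     \<and> alternating (insert {x, y} E - {{y, z}}) (z # r)"
| "alternating E [x, y] \<longleftrightarrow> x \<noteq> y \<and> {x, y} \<notin> E"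
| "alternating E _ \<longleftrightarrow> False"

fun flip :: "nat set set \<Rightarrow> nat list \<Rightarrow> nat set set" where
  "flip E (x # y # z # r) = flip (insert {x, y} E - {{y, z}}) (z # r)"
| "flip E [x, y] = insert {x, y} E"
| "flip E _ = E"

fun steps :: "nat list \<Rightarrow> nat set set" where
  "steps (x # y # r) = insert {x, y} (steps (y # r))"
| "steps _ = {}"

lemma flip_other: "e \<notin> steps xs \<Longrightarrow> e \<in> flip E xs \<longleftrightarrow> e \<in> E"
  by (induction E xs rule: flip.induct) auto

lemma insert_Diff_cancel:
  assumes "e \<notin> G" "f \<in> G" "e \<notin> H" "f \<in> H" "insert e G - {f} = insert e H - {f}"
  shows "G = H"
proof (rule set_eqI)
  fix x show "x \<in> G \<longleftrightarrow> x \<in> H"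
    using assms by (cases "x = e"; cases "x = f"; auto)
qed

text \<open>For a known list every single flip can be undone, since it is known which pair was
  inserted and which removed.\<close>

lemma flip_inj: "\<lbrakk>alternating E xs; alternating F xs; flip E xs = flip F xs\<rbrakk> \<Longrightarrow> E = F"
proof (induction E xs arbitrary: F rule: alternating.induct)
  case (1 E x y z r)
  have "insert {x, y} E - {{y, z}} = insert {x, y} F - {{y, z}}"
    by (rule "1.IH") (use "1.prems" in simp_all)
  then show ?case by (rule insert_Diff_cancel[rotated 4]) (use "1.prems" in simp_all)
next
  case (2 E x y)
  then show ?case by (simp add: insert_ident)
qed auto

lemma int_vertex_degree_insert:
  assumes "finite E" "e \<notin> E"
  shows "int (vertex_degree (insert e E) v) = int (vertex_degree E v) + of_bool (v \<in> e)"
proof -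
  have "{e' \<in> insert e E. v \<in> e'} = (if v \<in> e then insert e {e' \<in> E. v \<in> e'} else {e' \<in> E. v \<in> e'})"
    by auto
  then show ?thesis using assms by (simp add: vertex_degree_def)
qed

lemma int_vertex_degree_remove:
  assumes "finite E" "e \<in> E"
  shows "int (vertex_degree (E - {e}) v) = int (vertex_degree E v) - of_bool (v \<in> e)"
  using int_vertex_degree_insert[of "E - {e}" e v] assms by (simp add: insert_absorb)

lemma simple_graphs_insert:
  "E \<in> simple_graphs n \<Longrightarrow> x \<noteq> y \<Longrightarrow> x \<in> {1..n} \<Longrightarrow> y \<in> {1..n} \<Longrightarrow> insert {x, y} E \<in> simple_graphs n"
  by (auto simp: simple_graphs_def)

lemma realizations_cong:
  "(\<And>v. v \<in> {1..n} \<Longrightarrow> D v = D' v) \<Longrightarrow> realizations n D = realizations n D'"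
  by (auto simp: realizations_def)

text \<open>At inner vertices an inserted and a removed edge balance; only the two ends gain a
  unit.\<close>

lemma flip_realizes:
  "\<lbrakk>E \<in> realizations n D; alternating E xs; set xs \<subseteq> {1..n}\<rbrakk>
   \<Longrightarrow> flip E xs \<in> realizations n (\<lambda>v. D v + of_bool (v = hd xs) + of_bool (v = last xs))"
proof (induction E xs arbitrary: D rule: alternating.induct)
  case (1 E x y z r)
  let ?F = "insert {x, y} E"
  have E: "E \<in> simple_graphs n" using 1(2) by (simp add: realizations_def)
  have F: "?F \<in> simple_graphs n" using simple_graphs_insert[OF E, of x y] 1 by auto
  have yz: "y \<noteq> z"
  proof
    assume "y = z" then have "{y} \<in> E" using 1 by auto
    then show False using E by (auto simp: simple_graphs_def)
  qed
  \<comment> \<open>The first two steps move the deficit to \<open>z\<close>, the start of the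
    remaining trail.\<close>
  have "?F - {{y, z}} \<in> realizations n (\<lambda>v. D v + of_bool (v = x) - of_bool (v = z))"
    unfolding realizations_def
  proof (intro CollectI conjI ballI)
    show "?F - {{y, z}} \<in> simple_graphs n" using F by (auto simp: simple_graphs_def)
    fix v assume "v \<in> {1..n}"
    then show "int (vertex_degree (?F - {{y, z}}) v) = D v + of_bool (v = x) - of_bool (v = z)"
      using int_vertex_degree_insert[OF finite_edges[OF E], of "{x, y}" v]
        int_vertex_degree_remove[OF finite_edges[OF F], of "{y, z}" v] 1 yz
      by (auto simp: realizations_def)
  qed
  from 1(1)[OF this] 1(3,4) show ?case
    by (simp add: algebra_simps)
next
  case (2 E x y)
  have E: "E \<in> simple_graphs n" using 2 by (simp add: realizations_def)
  show ?case
    using simple_graphs_insert[OF E, of x y] 2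
      int_vertex_degree_insert[OF finite_edges[OF E], of "{x, y}"]
    by (auto simp: realizations_def)
qed auto

lemma card_flip_preimages_le:
  assumes "finite \<Gamma>"
  shows "card {E \<in> A. \<exists>xs. length xs = m \<and> set xs \<subseteq> {1..n} \<and> alternating E xs \<and> flip E xs \<in> \<Gamma>}
     \<le> card \<Gamma> * n ^ m" (is "card ?S \<le> _")
proof -
  let ?P = "\<lambda>E xs. length xs = m \<and> set xs \<subseteq> {1..n} \<and> alternating E xs \<and> flip E xs \<in> \<Gamma>"
  define c where "c E = (SOME xs. ?P E xs)" for E
  have c: "?P E (c E)" if "E \<in> ?S" for E
  proof -
    have "\<exists>xs. ?P E xs" using that by blast
    then show ?thesis unfolding c_def by (rule someI_ex)
  qed
  let ?L = "{xs. set xs \<subseteq> {1..n} \<and> length xs = m}"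
  have "card ?S \<le> card (\<Gamma> \<times> ?L)"
  proof (rule card_inj_on_le)
    show "inj_on (\<lambda>E. (flip E (c E), c E)) ?S"
    proof (rule inj_onI)
      fix E F assume E: "E \<in> ?S" and F: "F \<in> ?S" and eq: "(flip E (c E), c E) = (flip F (c F), c F)"
      have "c E = c F" "flip E (c E) = flip F (c F)" using eq by blast+
      moreover have "alternating E (c E)" "alternating F (c F)" using c[OF E] c[OF F] by blast+
      ultimately show "E = F" using flip_inj by metis
    qed
    show "(\<lambda>E. (flip E (c E), c E)) ` ?S \<subseteq> \<Gamma> \<times> ?L"
    proof (rule image_subsetI)
      fix E assume "E \<in> ?S"
      from c[OF this] show "(flip E (c E), c E) \<in> \<Gamma> \<times> ?L" by simp
    qed
    show "finite (\<Gamma> \<times> ?L)" using assms by (simp add: finite_lists_length_eq)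
  qed
  then show ?thesis by (simp add: card_cartesian_product card_lists_length_eq)
qed

section \<open>Weighted counting of trails with ten vertices\<close>

definition weave :: "nat list \<Rightarrow> nat \<Rightarrow> nat \<Rightarrow> nat list" where
  "weave k z z' = take 4 k @ [z, z'] @ drop 4 k"

text \<open>The function \<phi> stands for a set of candidates for \<open>z\<close> and
  \<open>z'\<close> that can be read off from the flipped graph and the other eight vertices. That
  there are at least as many trails as candidates is what makes the weights add up to one.\<close>

definition spread ::
    "nat \<Rightarrow> (nat set set \<Rightarrow> nat list \<Rightarrow> nat set) \<Rightarrow> nat set set set \<Rightarrow> nat set set \<Rightarrow> bool" where
  "spread n \<phi> \<Gamma> E \<longleftrightarrow> (\<exists>T. finite T \<and> T \<noteq> {} \<and> (\<forall>(k, z, z')\<in>T. length k = 8 \<and> set k \<subseteq> {1..n}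
     \<and> alternating E (weave k z z') \<and> flip E (weave k z z') \<in> \<Gamma>
     \<and> z \<in> \<phi> (flip E (weave k z z')) k \<and> z' \<in> \<phi> (flip E (weave k z z')) k
     \<and> card (\<phi> (flip E (weave k z z')) k) \<le> card T))"

text \<open>Each graph distributes a total weight of at least one over its trails; since a trail uses a
  pair from a set of size \<open>m\<close> and has weight \<open>1 / m\<close>, this pair costs \<open>m \<le> n\<close> instead of \<open>n ^ 2\<close>.\<close>

lemma card_spread_le:
  assumes \<Gamma>: "finite \<Gamma>" and A: "finite A" and \<phi>: "\<And>E k. \<phi> E k \<subseteq> {1..n}"
  shows "card {E \<in> A. spread n \<phi> \<Gamma> E} \<le> card \<Gamma> * n ^ 9"
proof -
  let ?B = "{E \<in> A. spread n \<phi> \<Gamma> E}"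
  let ?K = "{k. set k \<subseteq> {1..n} \<and> length k = 8}"
  have fin: "finite (\<phi> E k)" for E k using \<phi> by (rule finite_subset) simp
  let ?P = "\<lambda>E T. finite T \<and> T \<noteq> {} \<and> (\<forall>(k, z, z')\<in>T. length k = 8 \<and> set k \<subseteq> {1..n}
     \<and> alternating E (weave k z z') \<and> flip E (weave k z z') \<in> \<Gamma>
     \<and> z \<in> \<phi> (flip E (weave k z z')) k \<and> z' \<in> \<phi> (flip E (weave k z z')) k
     \<and> card (\<phi> (flip E (weave k z z')) k) \<le> card T)"
  define T where "T E = (SOME T. ?P E T)" for E
  have T: "?P E (T E)" if "E \<in> ?B" for E
  proof -
    have "\<exists>T. ?P E T" using that unfolding spread_def by blast
    then show ?thesis unfolding T_def by (rule someI_ex)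
  qed
  define h where "h = (\<lambda>(E, k, z, z'). (flip E (weave k z z'), k, z, z'))"
  define w where "w = (\<lambda>(E' :: nat set set, k :: nat list, z :: nat, z' :: nat). 1 / real (card (\<phi> E' k)))"
  let ?S = "SIGMA E':\<Gamma>. SIGMA k:?K. \<phi> E' k \<times> \<phi> E' k"
  have fK: "finite ?K" by (simp add: finite_lists_length_eq)
  have fS: "finite ?S" using \<Gamma> fK fin by (intro finite_SigmaI) auto
  have "real (card ?B) = (\<Sum>E\<in>?B. 1)" by simp
  also have "\<dots> \<le> (\<Sum>E\<in>?B. \<Sum>x\<in>T E. w (h (E, x)))"
  proof (rule sum_mono)
    fix E assume E: "E \<in> ?B"
    have pos: "card (T E) > 0" using T[OF E] by (simp add: card_gt_0_iff)
    have "1 = (\<Sum>x\<in>T E. 1 / real (card (T E)))" using pos by simp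
    also have "\<dots> \<le> (\<Sum>x\<in>T E. w (h (E, x)))"
    proof (rule sum_mono)
      fix x assume "x \<in> T E"
      then obtain k z z' where x: "x = (k, z, z')" "(k, z, z') \<in> T E" by (cases x) auto
      let ?c = "card (\<phi> (flip E (weave k z z')) k)"
      have "?c \<le> card (T E)" "z \<in> \<phi> (flip E (weave k z z')) k" using T[OF E] x by auto
      moreover from this have "?c > 0" using fin by (auto simp: card_gt_0_iff)
      ultimately show "1 / real (card (T E)) \<le> w (h (E, x))"
        by (simp add: w_def h_def x frac_le)
    qed
    finally show "1 \<le> (\<Sum>x\<in>T E. w (h (E, x)))" .
  qed
  also have "\<dots> = (\<Sum>y\<in>Sigma ?B T. w (h y))"
    using A T by (subst sum.Sigma) (auto simp: split_beta)
  also have "\<dots> = (\<Sum>y\<in>h ` Sigma ?B T. w y)"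
  proof -
    \<comment> \<open>The flipped graph and the trail together determine the original graph.\<close>
    have "inj_on h (Sigma ?B T)"
    proof (rule inj_onI)
      fix y1 y2 assume y: "y1 \<in> Sigma ?B T" "y2 \<in> Sigma ?B T" "h y1 = h y2"
      obtain E1 k z z' where 1: "y1 = (E1, k, z, z')" by (cases y1) auto
      then obtain E2 where 2: "y2 = (E2, k, z, z')" using y(3) by (cases y2) (auto simp: h_def)
      have "alternating E1 (weave k z z')" "alternating E2 (weave k z z')"
        using y(1,2) T[of E1] T[of E2] unfolding 1 2 by auto
      then show "y1 = y2" using flip_inj y(3) by (auto simp: 1 2 h_def)
    qed
    then show ?thesis by (simp add: sum.reindex)
  qed
  also have "\<dots> \<le> (\<Sum>y\<in>?S. w y)"
  proof (rule sum_mono2[OF fS])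
    show "h ` Sigma ?B T \<subseteq> ?S"
    proof
      fix y assume "y \<in> h ` Sigma ?B T"
      then obtain E k z z' where "E \<in> ?B" "(k, z, z') \<in> T E" "y = h (E, k, z, z')" by auto
      then show "y \<in> ?S" using T[of E] by (auto simp: h_def)
    qed
  qed (auto simp: w_def)
  also have "\<dots> = (\<Sum>E'\<in>\<Gamma>. \<Sum>k\<in>?K. \<Sum>y\<in>\<phi> E' k \<times> \<phi> E' k. 1 / real (card (\<phi> E' k)))"
  proof -
    have "(\<Sum>y\<in>?S. w y) = (\<Sum>E'\<in>\<Gamma>. \<Sum>x\<in>(SIGMA k:?K. \<phi> E' k \<times> \<phi> E' k). w (E', x))"
      using \<Gamma> fK fin by (subst sum.Sigma) (auto intro!: finite_SigmaI)
    also have "\<dots> = (\<Sum>E'\<in>\<Gamma>. \<Sum>k\<in>?K. \<Sum>y\<in>\<phi> E' k \<times> \<phi> E' k. w (E', k, y))"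
      using fK fin by (intro sum.cong refl, subst sum.Sigma) auto
    finally show ?thesis by (simp add: w_def split_beta)
  qed
  \<comment> \<open>With \<open>m\<close> candidates there are \<open>m ^ 2\<close> pairs of weight
    \<open>1 / m\<close>, in total \<open>m\<close> \<le> \<open>n\<close>; for \<open>m = 0\<close>
    the sum is empty.\<close>
  also have "\<dots> \<le> (\<Sum>E'\<in>\<Gamma>. \<Sum>k\<in>?K. real n)"
  proof (intro sum_mono)
    fix E' k
    have "card (\<phi> E' k) \<le> n" using card_mono[OF _ \<phi>[of E' k]] by simp
    then show "(\<Sum>y\<in>\<phi> E' k \<times> \<phi> E' k. 1 / real (card (\<phi> E' k))) \<le> real n"
      by (simp add: card_cartesian_product)
  qed
  also have "\<dots> = real (card \<Gamma> * n ^ 9)"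
    using power_add[of "real n" 8 1] by (simp add: card_lists_length_eq)
  finally show ?thesis by linarith
qed

section \<open>Graphs without short trails\<close>

lemma finite_graph_edges: "E \<in> simple_graphs n \<Longrightarrow> finite_graph {1..n} (\<lambda>u v. {u, v} \<in> E)"
  by unfold_locales (fastforce simp: simple_graphs_def insert_commute)+

lemma card_nbrs_edges:
  assumes E: "E \<in> simple_graphs n"
  shows "card {u. {v, u} \<in> E} = vertex_degree E v"
proof -
  have "{e \<in> E. v \<in> e} = (\<lambda>u. {v, u}) ` {u. {v, u} \<in> E}"
  proof (intro set_eqI iffI)
    fix e assume e: "e \<in> {e \<in> E. v \<in> e}"
    then have "card e = 2" using E by (auto simp: simple_graphs_def)
    then obtain x y where "e = {x, y}" "x \<noteq> y" by (meson card_2_iff)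
    then have "e = {v, if v = x then y else x}" using e by auto
    then show "e \<in> (\<lambda>u. {v, u}) ` {u. {v, u} \<in> E}" using e by auto
  qed auto
  moreover have "inj_on (\<lambda>u. {v, u}) {u. {v, u} \<in> E}"
    by (auto simp: inj_on_def doubleton_eq_iff)
  ultimately show ?thesis by (simp add: vertex_degree_def card_image)
qed

text \<open>An exchange argument: the values at \<open>K - {1..k}\<close> are at most
  \<open>d k\<close>, those at \<open>{1..k} - K\<close> at least \<open>d k\<close>, and both sets
  have the same size.\<close>

lemma sum_le_sum_initial:
  assumes d: "nonincreasing n d" and K: "K \<subseteq> {1..n}"
  shows "(\<Sum>v\<in>K. d v) \<le> (\<Sum>i=1..card K. d i)"
proof (cases "K = {}")
  case False
  define k where "k = card K"
  have fK: "finite K" using K finite_subset by blast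
  have k: "k \<in> {1..n}" using False fK K card_mono[OF _ K] by (auto simp: k_def Suc_le_eq card_gt_0_iff)
  let ?I = "{1..k}"
  have "(\<Sum>v\<in>K - ?I. d v) \<le> (\<Sum>v\<in>K - ?I. d k)"
    using d K k by (intro sum_mono) (auto simp: nonincreasing_def)
  moreover have "(\<Sum>v\<in>?I - K. d k) \<le> (\<Sum>v\<in>?I - K. d v)"
    using d K k by (intro sum_mono) (auto simp: nonincreasing_def)
  moreover have "card (K - ?I) = card (?I - K)"
    using fK by (intro card_le_sym_Diff antisym) (simp_all add: card_le_sym_Diff k_def)
  moreover have "(\<Sum>v\<in>K. d v) = (\<Sum>v\<in>K - ?I. d v) + (\<Sum>v\<in>K \<inter> ?I. d v)"
    using fK by (subst sum.union_disjoint[symmetric]) (auto intro: sum.cong)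
  moreover have "(\<Sum>v\<in>?I. d v) = (\<Sum>v\<in>?I - K. d v) + (\<Sum>v\<in>K \<inter> ?I. d v)"
    by (subst sum.union_disjoint[symmetric]) (auto intro: sum.cong)
  ultimately show ?thesis by (simp add: k_def)
qed simp

lemma stuck_if_no_short_trail:
  assumes n: "1 \<le> n" and d: "nonincreasing n d"
    and cap: "\<forall>k\<in>{1..n}. (\<Sum>i=1..k. d i) \<le> int k * (int k - 1) + d n * (int n - int k) + 1"
    and E: "E \<in> realizations n (\<lambda>v. d v + minus_ones s t v)"
    and st: "s \<in> {1..n}" "t \<in> {1..n}" "s \<noteq> t"
    and short: "\<And>xs. \<lbrakk>length xs \<in> {2, 4, 6, 8}; set xs \<subseteq> {1..n}; hd xs = s; last xs = t\<rbrakk> \<Longrightarrow> \<not> alternating E xs"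
  shows "stuck {1..n} (\<lambda>u v. {u, v} \<in> E) s t (d n)"
proof -
  have ES: "E \<in> simple_graphs n" using E by (simp add: realizations_def)
  interpret finite_graph "{1..n}" "\<lambda>u v. {u, v} \<in> E" using finite_graph_edges[OF ES] .
  have deg: "int (card (nbrs v)) = d v + minus_ones s t v" if "v \<in> {1..n}" for v
    using E that card_nbrs_edges[OF ES] by (simp add: nbrs_def realizations_def)
  have nadj: "nonadj x y \<longleftrightarrow> x \<in> {1..n} \<and> y \<in> {1..n} \<and> x \<noteq> y \<and> {x, y} \<notin> E" for x y
    by (rule nonadj_def)
  have V: "{x, y} \<in> E \<Longrightarrow> x \<in> {1..n} \<and> y \<in> {1..n} \<and> x \<noteq> y" for x y
    using in_V sym irrefl by blast
  have 2: "{s, t} \<in> E"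
    using short[of "[s, t]"] st by auto
  have 4: False if "nonadj s a" "{a, b} \<in> E" "nonadj b t" for a b
  proof -
    have "alternating E [s, a, b, t]"
      using that 2 st unfolding nadj by (auto simp: doubleton_eq_iff insert_commute)
    then show False using short[of "[s, a, b, t]"] that unfolding nadj by auto
  qed
  have 6: False if "nonadj s a" "{a, u} \<in> E" "nonadj u w" "{w, b} \<in> E" "nonadj b t" for a u w b
  proof -
    have "{a, b} \<notin> E" using 4 that by blast
    then have "alternating E [s, a, u, w, b, t]"
      using that 2 st V unfolding nadj by (auto simp: doubleton_eq_iff insert_commute)
    then show False using short[of "[s, a, u, w, b, t]"] that unfolding nadj by auto
  qed
  have 8: False if "nonadj s a" "{a, p} \<in> E" "nonadj p c" "{c, x} \<in> E" "nonadj x w" "{w, b} \<in> E" "nonadj b t"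
       "w \<noteq> s \<or> x \<noteq> a" "p \<noteq> t \<or> c \<noteq> b" "a \<noteq> b \<or> p \<noteq> w" for a p c x w b
  proof -
    \<comment> \<open>Apart from the three excluded configurations, repeating a step would force
      \<open>{a, b}\<close> to be an edge or contradict the assumptions on a single pair.\<close>
    have "{a, b} \<notin> E" using 4 that by blast
    moreover have "{p, w} \<in> E \<or> p = w"
      using 6[OF that(1,2) _ that(6,7)] V[OF that(2)] V[OF that(6)] unfolding nadj by auto
    ultimately have "alternating E [s, a, p, c, x, w, b, t]"
      using that 2 st V unfolding nadj by (auto simp: doubleton_eq_iff insert_commute)
    then show False using short[of "[s, a, p, c, x, w, b, t]"] that unfolding nadj by auto
  qed
  show ?thesis
  proof unfold_locales
    show "{s, t} \<in> E" using 2 .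
    show "\<lbrakk>v \<in> {1..n}; v \<noteq> s; v \<noteq> t\<rbrakk> \<Longrightarrow> d n \<le> int (card (nbrs v))" for v
      using deg[of v] d n by (auto simp: minus_ones_def nonincreasing_def)
    fix K assume K: "s \<in> K" "t \<in> K" "K \<subseteq> {1..n}"
    have fK: "finite K" using K finite_subset by blast
    \<comment> \<open>The two units missing at \<open>s\<close> and \<open>t\<close> turn the slack
      +1 into -1.\<close>
    have "(\<Sum>v\<in>K. minus_ones s t v) = (\<Sum>v\<in>{s, t}. -1)"
      using K fK by (intro sum.mono_neutral_cong_right) (auto simp: minus_ones_def)
    then have "(\<Sum>v\<in>K. int (card (nbrs v))) = (\<Sum>v\<in>K. d v) - 2"
      using deg K st by (simp add: sum.distrib subset_iff cong: sum.cong)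
    moreover have "card K \<in> {1..n}"
      using K fK card_mono[OF _ K(3)] by (auto simp: Suc_le_eq card_gt_0_iff)
    ultimately show "(\<Sum>v\<in>K. int (card (nbrs v))) + 1
       \<le> int (card K) * (int (card K) - 1) + d n * (int (card {1..n}) - int (card K))"
      using cap sum_le_sum_initial[OF d K(3)] by fastforce
  qed (use 4 6 8 in blast)+
qed

section \<open>Recovering the joined vertices after a flip\<close>

text \<open>A list \<open>k\<close> is a trail \<open>s a p u z z' d q b t\<close> without \<open>z\<close> and \<open>z'\<close>. From it and the flipped graph,
  \<open>core\<close> recovers \<open>X\<close>, with \<open>(i, j) = (1, 2)\<close> if \<open>X\<close> is made of the neighbourhoods of both \<open>a\<close>
  and \<open>b\<close>, and \<open>(i, j) = (6, 5)\<close> if it is made of that of \<open>b\<close> only.\<close>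

definition core :: "nat \<Rightarrow> nat \<Rightarrow> nat set set \<Rightarrow> nat list \<Rightarrow> nat set" where
  "core i j E k = {v. {k ! i, v} \<in> E} \<union> {v. {k ! 6, v} \<in> E} \<union> {k ! 0, k ! 7, k ! j, k ! 5}"

text \<open>The removed vertices are \<open>a\<close>, \<open>u\<close>, \<open>d\<close> and
  \<open>b\<close>, whose adjacency to \<open>X\<close> is altered by the flip. Between the core and
  all other vertices outside it the edges are unchanged.\<close>

definition hub :: "nat \<Rightarrow> nat \<Rightarrow> nat \<Rightarrow> nat set set \<Rightarrow> nat list \<Rightarrow> nat set" where
  "hub n i j E k = {v \<in> {1..n} - core i j E k - {k ! 1, k ! 3, k ! 4, k ! 6}. \<forall>y\<in>core i j E k. {v, y} \<in> E}"

lemma weave_eq: "weave [s, a, p, u, d, q, b, t] z z' = [s, a, p, u, z, z', d, q, b, t]"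
  by (simp add: weave_def)

lemma (in finite_graph) detour_vertices:
  "detour X s t a p u z z' d q b \<Longrightarrow> {s, a, p, u, z, z', d, q, b, t} \<subseteq> V"
  unfolding detour_def nonadj_def by blast

lemma detour_alternating:
  assumes "E \<in> simple_graphs n"
    and "finite_graph.detour {1..n} (\<lambda>u v. {u, v} \<in> E) X s t a p u z z' d q b"
  shows "alternating E [s, a, p, u, z, z', d, q, b, t]"
proof -
  interpret finite_graph "{1..n}" "\<lambda>u v. {u, v} \<in> E" using finite_graph_edges[OF assms(1)] .
  note D = assms(2)[unfolded detour_def nonadj_def]
  have ne: "a \<noteq> p" "u \<noteq> z" "z' \<noteq> d" "q \<noteq> b" using D irrefl by blast+
  have X: "s \<noteq> a" "s \<noteq> u" "s \<noteq> z" "s \<noteq> z'" "s \<noteq> d" "s \<noteq> b" "t \<noteq> a" "t \<noteq> u" "t \<noteq> z" "t \<noteq> z'" "t \<noteq> d" "t \<noteq> b"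
    "q \<noteq> a" "q \<noteq> u" "q \<noteq> z" "q \<noteq> z'" "q \<noteq> d" "q \<noteq> b" using D by blast+
  have "a \<noteq> u" using D by (auto simp: insert_commute)
  then show ?thesis using D ne X by (auto simp: doubleton_eq_iff)
qed

text \<open>The flip alters the neighbourhoods that define \<open>X\<close> only at
  \<open>s\<close>, \<open>t\<close>, \<open>q\<close> and, in the first case, \<open>p\<close>.
  These belong to \<open>X\<close> and are added to \<open>core\<close> explicitly, so
  \<open>core\<close> gives back \<open>X\<close>. The vertices \<open>z\<close> and
  \<open>z'\<close> survive the removals in \<open>hub\<close>: being joined to \<open>X\<close>
  they are adjacent to \<open>s\<close> and \<open>t\<close>, unlike \<open>a\<close> and
  \<open>b\<close>.\<close>

lemma hub_detour:
  assumes E: "E \<in> simple_graphs n"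
    and det: "finite_graph.detour {1..n} (\<lambda>u v. {u, v} \<in> E) X s t a p u z z' d q b"
    and k: "k = [s, a, p, u, d, q, b, t]"
    and ij: "i = 1 \<and> j = 2 \<and> p \<in> X \<and> a \<noteq> u \<and> a \<noteq> z \<and> a \<noteq> z' \<or> i = 6 \<and> j = 5 \<and> b \<noteq> a \<and> b \<noteq> p"
    and X: "X = {v. {k ! i, v} \<in> E} \<union> {v. {b, v} \<in> E} \<union> {s, t}"
    and J: "J = finite_graph.joined {1..n} (\<lambda>u v. {u, v} \<in> E) X"
  shows "hub n i j (flip E (weave k z z')) k \<subseteq> J"
    and "z \<in> J \<Longrightarrow> z' \<in> J \<Longrightarrow> {z, z'} \<subseteq> hub n i j (flip E (weave k z z')) k"
proof -
  interpret finite_graph "{1..n}" "\<lambda>u v. {u, v} \<in> E" using finite_graph_edges[OF E] .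
  note D = det[unfolded detour_def nonadj_def]
  define F where "F = flip E (weave k z z')"
  have F: "e \<in> F \<longleftrightarrow> e \<in> E"
    if "e \<notin> {{s, a}, {a, p}, {p, u}, {u, z}, {z, z'}, {z', d}, {d, q}, {q, b}, {b, t}}" for e
    using flip_other[of e "weave k z z'" E] that by (simp add: F_def k weave_eq)
  have ne: "a \<noteq> p" "u \<noteq> z" "z' \<noteq> d" "q \<noteq> b" using D irrefl by blast+
  have ne2: "s \<noteq> a" "s \<noteq> u" "s \<noteq> z" "s \<noteq> z'" "s \<noteq> d" "s \<noteq> b" "t \<noteq> a" "t \<noteq> u" "t \<noteq> z" "t \<noteq> z'" "t \<noteq> d" "t \<noteq> b"
    "q \<noteq> a" "q \<noteq> u" "q \<noteq> z" "q \<noteq> z'" "q \<noteq> d" "q \<noteq> b" using D by blast+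
  have core: "core i j F k = X"
    using ij
  proof (elim disjE conjE)
    assume i: "i = 1" "j = 2" and p: "p \<in> X" "a \<noteq> u" "a \<noteq> z" "a \<noteq> z'"
    have bp: "b \<noteq> p" using p D by blast
    have "{a, v} \<in> F \<longleftrightarrow> {a, v} \<in> E" "{b, v} \<in> F \<longleftrightarrow> {b, v} \<in> E" if "v \<notin> {s, t, p, q}" for v
      by (rule F; use that D ne ne2 p bp in \<open>auto simp: doubleton_eq_iff\<close>)+
    moreover have "{s, t, p, q} \<subseteq> X" using p D by blast
    ultimately show ?thesis using X unfolding core_def by (auto simp: k i)
  next
    assume i: "i = 6" "j = 5" and p: "b \<noteq> a" "b \<noteq> p"
    have "{b, v} \<in> F \<longleftrightarrow> {b, v} \<in> E" if "v \<notin> {s, t, q}" for v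
      by (rule F; use that D ne ne2 p in \<open>auto simp: doubleton_eq_iff\<close>)+
    moreover have "{s, t, q} \<subseteq> X" using D by blast
    ultimately show ?thesis using X unfolding core_def by (auto simp: k i)
  qed
  have cross: "{v, y} \<in> F \<longleftrightarrow> {v, y} \<in> E" if "v \<notin> X" "v \<notin> {a, u, d, b}" "y \<in> X" for v y
    by (rule F; use that D ne ne2 in \<open>auto simp: doubleton_eq_iff\<close>)+
  have hub: "hub n i j F k = J - {a, u, d, b}"
    unfolding hub_def core J joined_def using cross by (auto simp: k)
  show "hub n i j (flip E (weave k z z')) k \<subseteq> J"
    using hub by (auto simp: F_def)
  have "z \<notin> {a, u, d, b}" "z' \<notin> {a, u, d, b}" if "z \<in> J" "z' \<in> J"
  proof -
    have "{z, s} \<in> E" "{z', s} \<in> E" "{z', t} \<in> E" "{z, t} \<in> E"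
      using that D unfolding J joined_def by blast+
    moreover have "{a, s} \<notin> E" "{b, t} \<notin> E" using D by (auto simp: insert_commute)
    ultimately have "z \<noteq> a" "z' \<noteq> a" by auto
    moreover have "z \<noteq> d" using that D unfolding J joined_def by auto
    ultimately show "z \<notin> {a, u, d, b}" "z' \<notin> {a, u, d, b}" using D ne by auto
  qed
  then show "{z, z'} \<subseteq> hub n i j (flip E (weave k z z')) k" if "z \<in> J" "z' \<in> J"
    using hub that by (auto simp: F_def)
qed

lemma flip_realizes_restored:
  assumes "E \<in> realizations n (\<lambda>v. d v + minus_ones s t v)" "alternating E xs" "set xs \<subseteq> {1..n}"
    and "{hd xs, last xs} = {s, t}" "s \<noteq> t"
  shows "flip E xs \<in> realizations n d"
proof -
  have "realizations n (\<lambda>v. d v + minus_ones s t v + of_bool (v = hd xs) + of_bool (v = last xs)) = realizations n d"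
    using assms(4,5) by (intro realizations_cong) (auto simp: minus_ones_def doubleton_eq_iff)
  then show ?thesis using flip_realizes[OF assms(1-3)] by simp
qed

lemma minus_ones_commute: "minus_ones s t = minus_ones t s"
  by (auto simp: minus_ones_def fun_eq_iff)

text \<open>One detour is chosen for each triple. The parameter \<open>c\<close> merges the two
  shapes of \<open>X\<close>, with \<open>c = b\<close> if only the neighbourhood of
  \<open>b\<close> enters.\<close>

lemma spread_if_detours:
  fixes n :: nat and E :: "nat set set"
  defines "R \<equiv> \<lambda>u v. {u, v} \<in> E"
  assumes E: "E \<in> realizations n (\<lambda>v. d v + minus_ones s t v)"
    and J: "J = finite_graph.joined {1..n} R X" and T: "T = finite_graph.triples {1..n} R \<delta> X"
    and JT: "J \<noteq> {} \<and> card J \<le> card T"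
    and X: "X = {v. {c, v} \<in> E} \<union> {v. {b, v} \<in> E} \<union> {s, t}"
    and detours: "\<And>z z' e. (z, z', e) \<in> T \<Longrightarrow> z \<in> J \<and> z' \<in> J \<and>
      (\<exists>p u q. finite_graph.detour {1..n} R X s t a p u z z' e q b
        \<and> (i = 1 \<and> j = 2 \<and> c = a \<and> p \<in> X \<and> a \<noteq> u \<and> a \<noteq> z \<and> a \<noteq> z'
           \<or> i = 6 \<and> j = 5 \<and> c = b \<and> b \<noteq> a \<and> b \<noteq> p))"
  shows "spread n (hub n i j) (realizations n d) E"
proof -
  have ES: "E \<in> simple_graphs n" using E by (simp add: realizations_def)
  interpret finite_graph "{1..n}" R unfolding R_def using finite_graph_edges[OF ES] .
  have finJ: "finite J" unfolding J joined_def by simp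
  have finT: "finite T" "T \<noteq> {}"
  proof -
    have "card J > 0" using JT finJ by (simp add: card_gt_0_iff)
    then have "card T > 0" using JT by linarith
    then show "finite T" "T \<noteq> {}" by (simp_all add: card_gt_0_iff)
  qed
  define P where "P = (\<lambda>(z, z', e) (p, u, q). detour X s t a p u z z' e q b
        \<and> (i = 1 \<and> j = 2 \<and> c = a \<and> p \<in> X \<and> a \<noteq> u \<and> a \<noteq> z \<and> a \<noteq> z'
           \<or> i = 6 \<and> j = 5 \<and> c = b \<and> b \<noteq> a \<and> b \<noteq> p))"
  have "\<forall>x\<in>T. \<exists>y. P x y" using detours by (fastforce simp: P_def)
  then obtain f where f: "\<And>x. x \<in> T \<Longrightarrow> P x (f x)" by metis
  define g where "g = (\<lambda>(z, z', e). case f (z, z', e) of (p, u, q) \<Rightarrow> ([s, a, p, u, e, q, b, t], z, z'))"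
  \<comment> \<open>The triple is visible in its code: \<open>e\<close> is an entry of the list, and
    \<open>z\<close>, \<open>z'\<close> are the other two components.\<close>
  have "inj_on g T"
    by (rule inj_onI) (auto simp: g_def split: prod.splits)
  then have card: "card (g ` T) = card T" by (rule card_image)
  show ?thesis
    unfolding spread_def
  proof (intro exI[of _ "g ` T"] conjI ballI)
    show "finite (g ` T)" "g ` T \<noteq> {}" using finT by auto
    fix y assume "y \<in> g ` T"
    then obtain z z' e where x: "(z, z', e) \<in> T" "y = g (z, z', e)" by auto
    obtain p u q where fx: "f (z, z', e) = (p, u, q)" by (cases "f (z, z', e)") auto
    define k where "k = [s, a, p, u, e, q, b, t]"
    have y: "y = (k, z, z')" by (simp add: x g_def fx k_def)
    have P: "detour X s t a p u z z' e q b"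
      "i = 1 \<and> j = 2 \<and> c = a \<and> p \<in> X \<and> a \<noteq> u \<and> a \<noteq> z \<and> a \<noteq> z'
           \<or> i = 6 \<and> j = 5 \<and> c = b \<and> b \<noteq> a \<and> b \<noteq> p"
      using f[OF x(1)] by (auto simp: P_def fx)
    have V: "{s, a, p, u, z, z', e, q, b, t} \<subseteq> {1..n}" using detour_vertices[OF P(1)] .
    have w: "weave k z z' = [s, a, p, u, z, z', e, q, b, t]" by (simp add: k_def weave_eq)
    have alt: "alternating E (weave k z z')"
      unfolding w using detour_alternating[OF ES] P(1) unfolding R_def by blast
    have "s \<noteq> t" using P(1) unfolding detour_def by blast
    then have flip: "flip E (weave k z z') \<in> realizations n d"
      using V by (intro flip_realizes_restored[OF E alt]) (auto simp: w)
    have X': "X = {v. {k ! i, v} \<in> E} \<union> {v. {b, v} \<in> E} \<union> {s, t}"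
      using X P(2) by (auto simp: k_def)
    note hub = hub_detour[OF ES P(1)[unfolded R_def] k_def _ X' J[unfolded R_def]]
    have "hub n i j (flip E (weave k z z')) k \<subseteq> J"
      by (rule hub) (use P(2) in auto)
    moreover have "{z, z'} \<subseteq> hub n i j (flip E (weave k z z')) k"
      by (rule hub) (use P(2) detours[OF x(1)] in auto)
    moreover have "card (hub n i j (flip E (weave k z z')) k) \<le> card (g ` T)"
      using card_mono[OF finJ calculation(1)] JT card by linarith
    ultimately show "case y of (k, z, z') \<Rightarrow> length k = 8 \<and> set k \<subseteq> {1..n}
       \<and> alternating E (weave k z z') \<and> flip E (weave k z z') \<in> realizations n d
       \<and> z \<in> hub n i j (flip E (weave k z z')) k \<and> z' \<in> hub n i j (flip E (weave k z z')) k
       \<and> card (hub n i j (flip E (weave k z z')) k) \<le> card (g ` T)"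
      using alt flip V by (simp add: y) (simp add: k_def)
  qed
qed

text \<open>Any realization of \<open>d\<close> shows that \<open>d s\<close> is at most
  \<open>n - 1\<close>, while \<open>s\<close> has degree \<open>d s - 1\<close> in
  \<open>E\<close>.\<close>

lemma exists_nonadj:
  assumes g: "graphic n d" and E: "E \<in> realizations n (\<lambda>v. d v + minus_ones s t v)"
    and s: "s \<in> {1..n}"
  shows "\<exists>a. finite_graph.nonadj {1..n} (\<lambda>u v. {u, v} \<in> E) s a"
proof (rule ccontr)
  have ES: "E \<in> simple_graphs n" using E by (simp add: realizations_def)
  interpret finite_graph "{1..n}" "\<lambda>u v. {u, v} \<in> E" using finite_graph_edges[OF ES] .
  assume "\<not> ?thesis"
  then have "{1..n} - {s} \<subseteq> {u. {s, u} \<in> E}" using s unfolding nonadj_def by blast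
  moreover have "finite {u. {s, u} \<in> E}" using finite_nbrs[of s] by (simp add: nbrs_def)
  ultimately have "card ({1..n} - {s}) \<le> card {u. {s, u} \<in> E}" by (intro card_mono)
  then have "card ({1..n} - {s}) \<le> vertex_degree E s" unfolding card_nbrs_edges[OF ES] .
  moreover obtain F where F: "F \<in> realizations n d" using g by (auto simp: graphic_def)
  then have FS: "F \<in> simple_graphs n" by (simp add: realizations_def)
  interpret F: finite_graph "{1..n}" "\<lambda>u v. {u, v} \<in> F" using finite_graph_edges[OF FS] .
  have "{u. {s, u} \<in> F} \<subseteq> {1..n} - {s}" using F.nbrs_subset[of s] F.irrefl[of s] by (auto simp: F.nbrs_def)
  then have "card {u. {s, u} \<in> F} \<le> card ({1..n} - {s})" by (intro card_mono) simp_all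
  then have "vertex_degree F s \<le> card ({1..n} - {s})" unfolding card_nbrs_edges[OF FS] .
  ultimately have "int (vertex_degree F s) \<le> int (vertex_degree E s)" by simp
  moreover have "int (vertex_degree F s) = d s" using F s by (simp add: realizations_def)
  moreover have "int (vertex_degree E s) = d s - 1"
    using E s by (simp add: realizations_def minus_ones_def)
  ultimately show False by simp
qed

lemma short_or_spread:
  assumes n: "1 \<le> n" and d: "nonincreasing n d" and g: "graphic n d"
    and cap: "\<forall>k\<in>{1..n}. (\<Sum>i=1..k. d i) \<le> int k * (int k - 1) + d n * (int n - int k) + 1"
    and E: "E \<in> realizations n (\<lambda>v. d v + minus_ones s t v)"
    and ends: "s \<in> {1..n}" "t \<in> {1..n}" "s \<noteq> t"
  shows "(\<exists>m\<in>{2, 4, 6, 8}. \<exists>xs. length xs = m \<and> set xs \<subseteq> {1..n} \<and> alternating E xs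
           \<and> flip E xs \<in> realizations n d)
      \<or> spread n (hub n 1 2) (realizations n d) E \<or> spread n (hub n 6 5) (realizations n d) E"
proof (cases "\<exists>xs. length xs \<in> {2, 4, 6, 8} \<and> set xs \<subseteq> {1..n} \<and> hd xs = s \<and> last xs = t \<and> alternating E xs")
  case True
  then show ?thesis using flip_realizes_restored[OF E _ _ _ ends(3)] by blast
next
  case False
  let ?R = "\<lambda>u v. {u, v} \<in> E"
  interpret stuck "{1..n}" ?R s t "d n"
    by (rule stuck_if_no_short_trail[OF n d cap E ends]) (use False in blast)
  interpret sw: stuck "{1..n}" ?R t s "d n" by (rule swap)
  have E': "E \<in> realizations n (\<lambda>v. d v + minus_ones t s v)" using E by (simp add: minus_ones_commute)
  obtain a where a: "nonadj s a" using exists_nonadj[OF g E ends(1)] by blast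
  obtain b where tb: "nonadj t b" using exists_nonadj[OF g E' ends(2)] by blast
  have b: "nonadj b t" and as: "nonadj a s" using a tb nonadj_sym by blast+
  consider "clean s t a" "clean t s b" | "\<not> clean s t a" "clean t s b" | "\<not> clean t s b" "clean s t a"
    using clean_start_or_end[OF a b] by blast
  then show ?thesis
  proof cases
    case 1
    define X where "X = nbrs a \<union> nbrs b \<union> {s, t}"
    have "spread n (hub n 1 2) (realizations n d) E"
    proof (rule spread_if_detours[OF E refl refl])
      show "joined X \<noteq> {} \<and> card (joined X) \<le> card (triples (d n) X)"
        by (rule clean_detours(1)[OF a b 1 X_def])
      show "X = {v. {a, v} \<in> E} \<union> {v. {b, v} \<in> E} \<union> {s, t}" by (simp add: X_def nbrs_def)
    qed (use clean_detours(2)[OF a b 1 X_def] in blast)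
    then show ?thesis by blast
  next
    case 2
    define X where "X = nbrs b \<union> {s, t}"
    have "spread n (hub n 6 5) (realizations n d) E"
    proof (rule spread_if_detours[OF E refl refl])
      show "joined X \<noteq> {} \<and> card (joined X) \<le> card (triples (d n) X)"
        by (rule blossom_detours(1)[OF a b 2 X_def])
      show "X = {v. {b, v} \<in> E} \<union> {v. {b, v} \<in> E} \<union> {s, t}" by (simp add: X_def nbrs_def)
    qed (use blossom_detours(2)[OF a b 2 X_def] in blast)
    then show ?thesis by blast
  next
    \<comment> \<open>The mirror image of the preceding case. As \<open>spread\<close> does not
      mention the ends of the trails, it falls under the same set of codes.\<close>
    case 3
    define X where "X = nbrs a \<union> {t, s}"
    have "spread n (hub n 6 5) (realizations n d) E"
    proof (rule spread_if_detours[OF E' refl refl])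
      show "joined X \<noteq> {} \<and> card (joined X) \<le> card (triples (d n) X)"
        by (rule sw.blossom_detours(1)[OF tb as 3 X_def])
      show "X = {v. {a, v} \<in> E} \<union> {v. {a, v} \<in> E} \<union> {t, s}" by (simp add: X_def nbrs_def)
    qed (use sw.blossom_detours(2)[OF tb as 3 X_def] in blast)
    then show ?thesis by blast
  qed
qed

section \<open>Summation over all pairs of deficient vertices\<close>

text \<open>The pair can be recovered as the set of vertices whose degree is too small. Hence all
  numerators count one disjoint union, and no factor for the choice of the pair arises.\<close>

lemma realizations_minus_ones_disjoint:
  assumes "i < j" "i' < j'" "{i, j, i', j'} \<subseteq> {1..n}" "(i, j) \<noteq> (i', j')"
  shows "realizations n (\<lambda>v. d v + minus_ones i j v) \<inter> realizations n (\<lambda>v. d v + minus_ones i' j' v) = {}"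
proof (rule ccontr)
  assume "\<not> ?thesis"
  then obtain E where "E \<in> realizations n (\<lambda>v. d v + minus_ones i j v)"
    "E \<in> realizations n (\<lambda>v. d v + minus_ones i' j' v)" by blast
  then have "d v + minus_ones i j v = d v + minus_ones i' j' v" if "v \<in> {1..n}" for v
    using that unfolding realizations_def by (metis (mono_tags, lifting) mem_Collect_eq)
  then have "minus_ones i j v = minus_ones i' j' v" if "v \<in> {1..n}" for v
    using that by simp
  moreover have "minus_ones x y v = -1 \<longleftrightarrow> v \<in> {x, y}" for x y v
    by (simp add: minus_ones_def)
  ultimately have "v \<in> {i, j} \<longleftrightarrow> v \<in> {i', j'}" if "v \<in> {1..n}" for v
    using that by metis
  then have "{i, j} = {i', j'}" using assms(3) by blast
  then show False using assms by (auto simp: doubleton_eq_iff)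
qed

theorem theorem4p4:
  fixes n :: nat and d :: "nat \<Rightarrow> int"
  assumes "1 \<le> n"
    and "nonincreasing n d"
    and "graphic n d"
    and "\<forall>k\<in>{1..n}. (\<Sum>i=1..k. d i) \<le> int k * (int k - 1) + d n * (int n - int k) + 1"
  shows "pp n d \<le> 3 * real n ^ 9"
\<comment> \<open>For \<open>n = 1\<close> there are no pairs; the comparison of powers at the end
  uses \<open>2 \<le> n\<close>.\<close>
proof (cases "n = 1")
  case True
  then show ?thesis by (simp add: pp_def)
next
  case False
  then have n2: "2 \<le> n" using assms(1) by simp
  define \<Gamma> where "\<Gamma> = realizations n d"
  define D where "D = (\<lambda>(i, j). realizations n (\<lambda>v. d v + minus_ones i j v))"
  define P where "P = (SIGMA i:{1..n}. {i+1..n})"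
  define \<Omega> where "\<Omega> = (\<Union>x\<in>P. D x)"
  have fin: "finite \<Gamma>" "finite P" "finite (D x)" "finite \<Omega>" for x
    by (auto simp: \<Gamma>_def P_def D_def \<Omega>_def finite_realizations split: prod.splits)
  have pos: "card \<Gamma> > 0" using assms(3) fin by (auto simp: card_gt_0_iff graphic_def \<Gamma>_def)
  have "(\<Sum>i=1..n. \<Sum>j=i+1..n. card (D (i, j))) = (\<Sum>x\<in>P. card (D x))"
    unfolding P_def by (subst sum.Sigma) auto
  also have "\<dots> = card \<Omega>"
    unfolding \<Omega>_def
  proof (rule card_UN_disjoint[symmetric])
    show "\<forall>x\<in>P. \<forall>y\<in>P. x \<noteq> y \<longrightarrow> D x \<inter> D y = {}"
    proof (intro ballI impI)
      fix x y assume "x \<in> P" "y \<in> P" "x \<noteq> y"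
      then show "D x \<inter> D y = {}"
        using realizations_minus_ones_disjoint[of "fst x" "snd x" "fst y" "snd y" n d]
        by (auto simp: D_def P_def split_beta prod_eq_iff)
    qed
  qed (use fin in auto)
  finally have pp: "pp n d = real (card \<Omega>) / real (card \<Gamma>)"
    by (simp add: pp_def D_def \<Gamma>_def sum_divide_distrib[symmetric] flip: of_nat_sum)
  define S where "S m = {E \<in> \<Omega>. \<exists>xs. length xs = m \<and> set xs \<subseteq> {1..n} \<and> alternating E xs \<and> flip E xs \<in> \<Gamma>}" for m
  define C where "C i j = {E \<in> \<Omega>. spread n (hub n i j) \<Gamma> E}" for i j
  have S: "card (S m) \<le> card \<Gamma> * n ^ m" for m
    unfolding S_def by (rule card_flip_preimages_le[OF fin(1)])
  have C: "card (C i j) \<le> card \<Gamma> * n ^ 9" for i j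
    unfolding C_def by (rule card_spread_le[OF fin(1,4)]) (auto simp: hub_def)
  have "\<Omega> \<subseteq> S 2 \<union> S 4 \<union> S 6 \<union> S 8 \<union> C 1 2 \<union> C 6 5"
  proof
    fix E assume "E \<in> \<Omega>"
    then obtain s t where "(s, t) \<in> P" "E \<in> D (s, t)" by (auto simp: \<Omega>_def)
    then have "s \<in> {1..n}" "t \<in> {1..n}" "s \<noteq> t"
      "E \<in> realizations n (\<lambda>v. d v + minus_ones s t v)" by (auto simp: P_def D_def)
    from short_or_spread[OF assms this(4,1-3)] \<open>E \<in> \<Omega>\<close>
    show "E \<in> S 2 \<union> S 4 \<union> S 6 \<union> S 8 \<union> C 1 2 \<union> C 6 5"
      unfolding S_def C_def \<Gamma>_def by blast
  qed
  then have "card \<Omega> \<le> card (S 2 \<union> S 4 \<union> S 6 \<union> S 8 \<union> C 1 2 \<union> C 6 5)"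
    using fin by (intro card_mono) (auto simp: S_def C_def)
  also have "\<dots> \<le> card (S 2) + card (S 4) + card (S 6) + card (S 8) + card (C 1 2) + card (C 6 5)"
    by (meson card_Un_le add_le_mono le_refl order_trans)
  also have "\<dots> \<le> card \<Gamma> * (n ^ 2 + n ^ 4 + n ^ 6 + n ^ 8 + n ^ 9 + n ^ 9)"
    using S[of 2] S[of 4] S[of 6] S[of 8] C[of 1 2] C[of 6 5] by (simp add: distrib_left)
  also have "\<dots> \<le> card \<Gamma> * (3 * n ^ 9)"
  proof (rule mult_left_mono)
    \<comment> \<open>By repeated doubling, \<open>n ^ 2 + n ^ 4 + n ^ 6 + n ^ 8\<close> is at most
      \<open>n ^ 9\<close>. The other two summands \<open>n ^ 9\<close> come from the two kinds of
      hub.\<close>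
    have h: "2 * n ^ k \<le> n ^ Suc k" for k using n2 by simp
    show "n ^ 2 + n ^ 4 + n ^ 6 + n ^ 8 + n ^ 9 + n ^ 9 \<le> 3 * n ^ 9"
      using h[of 2] h[of 3] h[of 4] h[of 5] h[of 6] h[of 7] h[of 8] by simp
  qed simp
  finally have "real (card \<Omega>) \<le> real (card \<Gamma> * (3 * n ^ 9))" by linarith
  then show ?thesis using pos by (simp add: pp field_simps)
qed

end
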